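(* Let $H$ be a pointed Hopf algebra over a field $\Bbbk$ and let $B$ be a right $H$-simple left $H$-comodule algebra. For every finite-dimensional $H$-comodule subalgebra $A$ of $B$, $B$ is free as a (right) $A$-module.
   Context: Everything is over a field $\Bbbk$; $H$ and $B$ may be infinite-dimensional. A Hopf algebra is pointed if each of its simple subcoalgebras is one-dimensional. A left $H$-comodule algebra is an algebra that is a left $H$-comodule whose coaction is an algebra map. It is right $H$-simple if it is nonzero and its only right ideals that are $H$-subcomodules are zero and itself. An $H$-comodule subalgebra is a (unital) subalgebra that is an $H$-subcomodule. $B$ is an $A$-module by right multiplication. *)

theory Defs
  imports Complex_Main "HOL-Library.Function_Algebras"
begin

text \<open>
  Algebraic structures live on whole types; the action of the base field is an explicit function
  \<open>scale\<close>, as in the locale \<^locale>\<open>vector_space\<close>. No finite-dimensionality is built in.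
\<close>

section \<open>Tensor products of vector spaces\<close>

text \<open>
  The tensor product of \<open>V\<close> and \<open>W\<close> over the field \<open>'k\<close> is realised inside the functions on
  forms \<open>V \<times> W \<rightarrow> 'k\<close>: the pure tensor of \<open>v\<close> and \<open>w\<close> is evaluation of bilinear forms at \<open>(v, w)\<close>
  (with the value \<open>0\<close> at forms that are not bilinear), and the tensor product is the span of the
  pure tensors. Since bilinear forms separate points of the abstract tensor product over a field,
  in any dimension, this is the tensor product up to canonical isomorphism; its universal property
  is proved below (\<open>tensor_lift_tens\<close>, \<open>tensor_lift_add\<close>, \<open>tensor_lift_scale\<close>,
  \<open>tensor_lift_unique\<close>).
\<close>

definition bilinear_map ::
    "('k::field \<Rightarrow> 'v::ab_group_add \<Rightarrow> 'v) \<Rightarrow> ('k \<Rightarrow> 'w::ab_group_add \<Rightarrow> 'w) \<Rightarrow>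
     ('k \<Rightarrow> 'u::ab_group_add \<Rightarrow> 'u) \<Rightarrow> ('v \<Rightarrow> 'w \<Rightarrow> 'u) \<Rightarrow> bool" where
  "bilinear_map s1 s2 s3 f \<longleftrightarrow>
     (\<forall>v. Vector_Spaces.linear s2 s3 (f v)) \<and> (\<forall>w. Vector_Spaces.linear s1 s3 (\<lambda>v. f v w))"

type_synonym ('k, 'v, 'w) tensor = "('v \<Rightarrow> 'w \<Rightarrow> 'k) \<Rightarrow> 'k"

definition tscale :: "'k::field \<Rightarrow> ('x \<Rightarrow> 'k) \<Rightarrow> 'x \<Rightarrow> 'k" where
  "tscale c T = (\<lambda>\<beta>. c * T \<beta>)"

definition tens ::
    "('k::field \<Rightarrow> 'v::ab_group_add \<Rightarrow> 'v) \<Rightarrow> ('k \<Rightarrow> 'w::ab_group_add \<Rightarrow> 'w) \<Rightarrow>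
     'v \<Rightarrow> 'w \<Rightarrow> ('k, 'v, 'w) tensor" where
  "tens s1 s2 v w = (\<lambda>\<beta>. if bilinear_map s1 s2 (*) \<beta> then \<beta> v w else 0)"

text \<open>
  For subspaces \<open>V\<close>, \<open>W\<close> this is the image of the tensor product of \<open>V\<close> and \<open>W\<close> in the tensor
  product of the ambient spaces (over a field, the map between the two is injective).
\<close>

definition tensor_space ::
    "('k::field \<Rightarrow> 'v::ab_group_add \<Rightarrow> 'v) \<Rightarrow> ('k \<Rightarrow> 'w::ab_group_add \<Rightarrow> 'w) \<Rightarrow>
     'v set \<Rightarrow> 'w set \<Rightarrow> ('k, 'v, 'w) tensor set" where
  "tensor_space s1 s2 V W = module.span tscale {tens s1 s2 v w | v w. v \<in> V \<and> w \<in> W}"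

text \<open>
  The map on the tensor product induced by a bilinear map \<open>f\<close>. It is meaningful only for bilinear
  \<open>f\<close> and for \<open>T\<close> in the tensor product; then the value does not depend on how \<open>T\<close> is written
  as a sum of pure tensors.
\<close>

definition tensor_lift ::
    "('k::field \<Rightarrow> 'v::ab_group_add \<Rightarrow> 'v) \<Rightarrow> ('k \<Rightarrow> 'w::ab_group_add \<Rightarrow> 'w) \<Rightarrow>
     ('v \<Rightarrow> 'w \<Rightarrow> 'u::ab_group_add) \<Rightarrow> ('k, 'v, 'w) tensor \<Rightarrow> 'u" where
  "tensor_lift s1 s2 f T =
     (THE u. \<exists>xs. T = (\<Sum>(v, w)\<leftarrow>xs. tens s1 s2 v w) \<and> u = (\<Sum>(v, w)\<leftarrow>xs. f v w))"

lemma vector_space_tscale: "vector_space (tscale :: 'k::field \<Rightarrow> ('x \<Rightarrow> 'k) \<Rightarrow> 'x \<Rightarrow> 'k)"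
  by unfold_locales (auto simp: tscale_def fun_eq_iff algebra_simps)

lemma bilinear_map_scale_left:
  "bilinear_map s1 s2 s3 f \<Longrightarrow> f (s1 c v) w = s3 c (f v w)"
  unfolding bilinear_map_def linear_iff_module_hom
  using module_hom.scale[of s1 s3 "\<lambda>v. f v w"] by blast

lemma bilinear_map_tens:
  assumes "vector_space s1" "vector_space s2"
  shows "bilinear_map s1 s2 tscale (tens s1 s2)"
proof -
  interpret v1: vector_space s1 by fact
  interpret v2: vector_space s2 by fact
  interpret t: vector_space tscale by (rule vector_space_tscale)
  have lin2: "Vector_Spaces.linear s2 (*) (\<beta> v)" if "bilinear_map s1 s2 (*) \<beta>" for \<beta> v
    using that by (simp add: bilinear_map_def)
  have lin1: "Vector_Spaces.linear s1 (*) (\<lambda>v. \<beta> v w)" if "bilinear_map s1 s2 (*) \<beta>" for \<beta> w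
    using that by (simp add: bilinear_map_def)
  show ?thesis
    unfolding bilinear_map_def
  proof (intro conjI allI)
    fix v show "Vector_Spaces.linear s2 tscale (tens s1 s2 v)"
      by unfold_locales
        (auto simp: tens_def tscale_def fun_eq_iff
              module_hom.add[OF module_hom_linearI[OF lin2]]
              module_hom.scale[OF module_hom_linearI[OF lin2]])
  next
    fix w show "Vector_Spaces.linear s1 tscale (\<lambda>v. tens s1 s2 v w)"
      by unfold_locales
        (auto simp: tens_def tscale_def fun_eq_iff
              module_hom.add[OF module_hom_linearI[OF lin1]]
              module_hom.scale[OF module_hom_linearI[OF lin1]])
  qed
qed

lemma sum_list_tens_apply:
  "(\<Sum>(v, w)\<leftarrow>xs. tens s1 s2 v w) \<beta> =
     (if bilinear_map s1 s2 (*) \<beta> then (\<Sum>(v, w)\<leftarrow>xs. \<beta> v w) else 0)"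
  by (induction xs) (auto simp: tens_def)

lemma tensor_space_sum_list:
  assumes "vector_space s1" "vector_space s2" "T \<in> tensor_space s1 s2 UNIV UNIV"
  obtains xs where "T = (\<Sum>(v, w)\<leftarrow>xs. tens s1 s2 v w)"
proof -
  interpret t: vector_space tscale by (rule vector_space_tscale)
  have "\<exists>xs. T = (\<Sum>(v, w)\<leftarrow>xs. tens s1 s2 v w)"
    using assms(3) unfolding tensor_space_def
  proof (induction rule: t.span_induct_alt)
    case base
    show ?case by (rule exI[of _ "[]"]) simp
  next
    case (step c x y)
    from step obtain v w xs where
      x: "x = tens s1 s2 v w" and y: "y = (\<Sum>(v, w)\<leftarrow>xs. tens s1 s2 v w)" by auto
    have "tscale c (tens s1 s2 v w) = tens s1 s2 (s1 c v) w"
      using bilinear_map_scale_left[OF bilinear_map_tens[OF assms(1,2)]] by metis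
    then show ?case
      by (intro exI[of _ "(s1 c v, w) # xs"]) (simp add: x y)
  qed
  then show thesis using that by blast
qed

lemma tensor_lift_sum_list:
  assumes f: "bilinear_map s1 s2 s3 f"
  shows "tensor_lift s1 s2 f (\<Sum>(v, w)\<leftarrow>xs. tens s1 s2 v w) = (\<Sum>(v, w)\<leftarrow>xs. f v w)"
  unfolding tensor_lift_def
proof (rule the_equality)
  show "\<exists>ys. (\<Sum>(v, w)\<leftarrow>xs. tens s1 s2 v w) = (\<Sum>(v, w)\<leftarrow>ys. tens s1 s2 v w) \<and>
          (\<Sum>(v, w)\<leftarrow>xs. f v w) = (\<Sum>(v, w)\<leftarrow>ys. f v w)" by blast
next
  fix u
  assume "\<exists>ys. (\<Sum>(v, w)\<leftarrow>xs. tens s1 s2 v w) = (\<Sum>(v, w)\<leftarrow>ys. tens s1 s2 v w) \<and>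
          u = (\<Sum>(v, w)\<leftarrow>ys. f v w)"
  then obtain ys where eq: "(\<Sum>(v, w)\<leftarrow>xs. tens s1 s2 v w) = (\<Sum>(v, w)\<leftarrow>ys. tens s1 s2 v w)"
    and u: "u = (\<Sum>(v, w)\<leftarrow>ys. f v w)" by blast
  have l2: "Vector_Spaces.linear s2 s3 (f v)" for v using f by (simp add: bilinear_map_def)
  have l1: "Vector_Spaces.linear s1 s3 (\<lambda>v. f v w)" for w using f by (simp add: bilinear_map_def)
  interpret v3: vector_space s3 using l2 by (simp add: Vector_Spaces.linear_def)
  interpret k: vector_space "(*) :: 'a \<Rightarrow> 'a \<Rightarrow> 'a" by unfold_locales (auto simp: algebra_simps)
  interpret p: vector_space_pair s3 "(*) :: 'a \<Rightarrow> 'a \<Rightarrow> 'a" ..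
  have sep: "x = 0" if "\<And>\<phi>. Vector_Spaces.linear s3 (*) \<phi> \<Longrightarrow> \<phi> x = 0" for x
  proof (rule ccontr)
    assume "x \<noteq> 0"
    then have ind: "v3.independent {x}" by (simp add: v3.dependent_single)
    have "p.construct {x} (\<lambda>_. 1) x = 0" by (rule that) (rule p.linear_construct[OF ind])
    then show False using p.construct_basis[OF ind, of x "\<lambda>_. 1"] by simp
  qed
  have "\<phi> (\<Sum>(v, w)\<leftarrow>xs. f v w) = \<phi> (\<Sum>(v, w)\<leftarrow>ys. f v w)"
    if \<phi>: "Vector_Spaces.linear s3 (*) \<phi>" for \<phi>
  proof -
    have b: "bilinear_map s1 s2 (*) (\<lambda>v w. \<phi> (f v w))"
      unfolding bilinear_map_def
      using Vector_Spaces.linear_compose[OF l1 \<phi>] Vector_Spaces.linear_compose[OF l2 \<phi>]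
      by (simp add: o_def)
    have s: "\<phi> (\<Sum>(v, w)\<leftarrow>zs. f v w) = (\<Sum>(v, w)\<leftarrow>zs. tens s1 s2 v w) (\<lambda>v w. \<phi> (f v w))" for zs
      using \<phi> unfolding sum_list_tens_apply
      by (induction zs)
         (auto simp: b linear_iff_module_hom module_hom.add module_hom.zero)
    show ?thesis by (simp only: s eq)
  qed
  then have "(\<Sum>(v, w)\<leftarrow>xs. f v w) - (\<Sum>(v, w)\<leftarrow>ys. f v w) = 0"
    by (intro sep) (simp add: linear_iff_module_hom module_hom.diff)
  then show "u = (\<Sum>(v, w)\<leftarrow>xs. f v w)" by (simp add: u)
qed

lemma tensor_lift_tens:
  assumes "bilinear_map s1 s2 s3 f"
  shows "tensor_lift s1 s2 f (tens s1 s2 v w) = f v w"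
  using tensor_lift_sum_list[OF assms, of "[(v, w)]"] by simp

lemma tensor_lift_add:
  assumes f: "bilinear_map s1 s2 s3 f"
    and "T \<in> tensor_space s1 s2 UNIV UNIV" "S \<in> tensor_space s1 s2 UNIV UNIV"
  shows "tensor_lift s1 s2 f (T + S) = tensor_lift s1 s2 f T + tensor_lift s1 s2 f S"
proof -
  have vs: "vector_space s1" "vector_space s2"
    using f by (auto simp: bilinear_map_def Vector_Spaces.linear_def)
  obtain xs ys where "T = (\<Sum>(v, w)\<leftarrow>xs. tens s1 s2 v w)" "S = (\<Sum>(v, w)\<leftarrow>ys. tens s1 s2 v w)"
    using assms(2,3) tensor_space_sum_list[OF vs] by metis
  then show ?thesis
    using tensor_lift_sum_list[OF f, of "xs @ ys"]
    by (simp add: tensor_lift_sum_list[OF f])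
qed

lemma tensor_lift_scale:
  assumes f: "bilinear_map s1 s2 s3 f" and "T \<in> tensor_space s1 s2 UNIV UNIV"
  shows "tensor_lift s1 s2 f (tscale c T) = s3 c (tensor_lift s1 s2 f T)"
proof -
  have vs: "vector_space s1" "vector_space s2" "vector_space s3"
    using f by (auto simp: bilinear_map_def Vector_Spaces.linear_def)
  obtain xs where T: "T = (\<Sum>(v, w)\<leftarrow>xs. tens s1 s2 v w)"
    using assms(2) tensor_space_sum_list[OF vs(1,2)] by metis
  have mh: "module s" if "vector_space s" for s :: "'a \<Rightarrow> 'z::ab_group_add \<Rightarrow> 'z"
    using that by (simp add: module_iff_vector_space)
  have d: "(\<Sum>(v, w)\<leftarrow>map (\<lambda>(v, w). (s1 c v, w)) xs. g v w) = s c (\<Sum>(v, w)\<leftarrow>xs. g v w)"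
    if g: "bilinear_map s1 s2 s g" and "vector_space s"
    for s :: "'a \<Rightarrow> 'z::ab_group_add \<Rightarrow> 'z" and g
    by (induction xs)
       (auto simp: bilinear_map_scale_left[OF g] module.scale_right_distrib[OF mh[OF that(2)]]
          module.scale_zero_right[OF mh[OF that(2)]])
  show ?thesis
    unfolding T d[OF bilinear_map_tens[OF vs(1,2)] vector_space_tscale, symmetric]
      tensor_lift_sum_list[OF f]
    by (rule d[OF f vs(3)])
qed

lemma tensor_lift_unique:
  assumes f: "bilinear_map s1 s2 s3 f"
    and add: "\<And>T S. T \<in> tensor_space s1 s2 UNIV UNIV \<Longrightarrow> S \<in> tensor_space s1 s2 UNIV UNIV \<Longrightarrow>
        g (T + S) = g T + g S"
    and g: "\<And>v w. g (tens s1 s2 v w) = f v w"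
    and T: "T \<in> tensor_space s1 s2 UNIV UNIV"
  shows "g T = tensor_lift s1 s2 f T"
proof -
  interpret t: vector_space tscale by (rule vector_space_tscale)
  have vs: "vector_space s1" "vector_space s2"
    using f by (auto simp: bilinear_map_def Vector_Spaces.linear_def)
  have tin: "tens s1 s2 v w \<in> tensor_space s1 s2 UNIV UNIV" for v w
    unfolding tensor_space_def by (rule t.span_base) blast
  have z: "(0 :: ('a, 'b, 'c) tensor) \<in> tensor_space s1 s2 UNIV UNIV"
    unfolding tensor_space_def by (rule t.span_zero)
  have g0: "g 0 = 0" using add[OF z z] by simp
  have sin: "(\<Sum>(v, w)\<leftarrow>xs. tens s1 s2 v w) \<in> tensor_space s1 s2 UNIV UNIV" for xs
  proof (induction xs)
    case Nil
    show ?case using z by (simp add: zero_fun_def)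
  next
    case (Cons p xs)
    obtain v w where "p = (v, w)" by force
    then show ?case
      using t.span_add[OF tin[unfolded tensor_space_def] Cons[unfolded tensor_space_def]]
      unfolding tensor_space_def by (simp del: plus_fun_apply)
  qed
  obtain xs where xs: "T = (\<Sum>(v, w)\<leftarrow>xs. tens s1 s2 v w)"
    using T tensor_space_sum_list[OF vs] by metis
  have "g (\<Sum>(v, w)\<leftarrow>xs. tens s1 s2 v w) = (\<Sum>(v, w)\<leftarrow>xs. f v w)"
  proof (induction xs)
    case Nil
    show ?case using g0 by (simp add: zero_fun_def)
  next
    case (Cons p xs)
    obtain v w where "p = (v, w)" by force
    then show ?case using add[OF tin sin, of v w xs] Cons by (simp add: g del: plus_fun_apply)
  qed
  then show ?thesis by (simp add: xs tensor_lift_sum_list[OF f])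
qed

section \<open>Coalgebras and comodules\<close>

text \<open>
  In Sweedler notation, the next two maps send a sum of \<open>x \<otimes> v\<close> in \<open>C \<otimes> V\<close> to the sum of
  \<open>x\<^sub>1 \<otimes> (x\<^sub>2 \<otimes> v)\<close>, respectively of \<open>x \<otimes> (v\<^bsub>-1\<^esub> \<otimes> v\<^bsub>0\<^esub>)\<close>; that is, they are \<open>\<Delta> \<otimes> id\<close> followed by the
  associativity isomorphism \<open>(C \<otimes> C) \<otimes> V \<rightarrow> C \<otimes> (C \<otimes> V)\<close>, and \<open>id \<otimes> \<rho>\<close>.
\<close>

definition comult_tensor_id ::
    "('k::field \<Rightarrow> 'c::ab_group_add \<Rightarrow> 'c) \<Rightarrow> ('k \<Rightarrow> 'v::ab_group_add \<Rightarrow> 'v) \<Rightarrow>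
     ('c \<Rightarrow> ('k, 'c, 'c) tensor) \<Rightarrow> ('k, 'c, 'v) tensor \<Rightarrow> ('k, 'c, ('k, 'c, 'v) tensor) tensor" where
  "comult_tensor_id sC sV \<Delta> =
     tensor_lift sC sV (\<lambda>x v. tensor_lift sC sC (\<lambda>a b. tens sC tscale a (tens sC sV b v)) (\<Delta> x))"

definition id_tensor_coact ::
    "('k::field \<Rightarrow> 'c::ab_group_add \<Rightarrow> 'c) \<Rightarrow> ('k \<Rightarrow> 'v::ab_group_add \<Rightarrow> 'v) \<Rightarrow>
     ('v \<Rightarrow> ('k, 'c, 'v) tensor) \<Rightarrow> ('k, 'c, 'v) tensor \<Rightarrow> ('k, 'c, ('k, 'c, 'v) tensor) tensor" where
  "id_tensor_coact sC sV \<rho> = tensor_lift sC sV (\<lambda>x v. tens sC tscale x (\<rho> v))"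

locale coalgebra = vector_space scale
  for scale :: "'k::field \<Rightarrow> 'c::ab_group_add \<Rightarrow> 'c" +
  fixes \<Delta> :: "'c \<Rightarrow> ('k, 'c, 'c) tensor"
    and \<epsilon> :: "'c \<Rightarrow> 'k"
  assumes comult_in_tensor: "\<Delta> x \<in> tensor_space scale scale UNIV UNIV"
    and comult_linear: "Vector_Spaces.linear scale tscale \<Delta>"
    and counit_linear: "Vector_Spaces.linear scale (*) \<epsilon>"
    and coassoc: "comult_tensor_id scale scale \<Delta> (\<Delta> x) = id_tensor_coact scale scale \<Delta> (\<Delta> x)"
    and counit_left: "tensor_lift scale scale (\<lambda>a b. scale (\<epsilon> a) b) (\<Delta> x) = x"
    and counit_right: "tensor_lift scale scale (\<lambda>a b. scale (\<epsilon> b) a) (\<Delta> x) = x"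
begin

definition subcoalgebra :: "'c set \<Rightarrow> bool" where
  "subcoalgebra D \<longleftrightarrow> subspace D \<and> \<Delta> ` D \<subseteq> tensor_space scale scale D D"

definition simple_subcoalgebra :: "'c set \<Rightarrow> bool" where
  "simple_subcoalgebra D \<longleftrightarrow>
     subcoalgebra D \<and> D \<noteq> {0} \<and> (\<forall>E. subcoalgebra E \<and> E \<subseteq> D \<longrightarrow> E = {0} \<or> E = D)"

definition pointed :: bool where
  "pointed \<longleftrightarrow> (\<forall>D. simple_subcoalgebra D \<longrightarrow> dim D = 1)"

end

locale left_comodule = H: coalgebra scaleH \<Delta> \<epsilon> + V: vector_space scaleV
  for scaleH :: "'k::field \<Rightarrow> 'h::ab_group_add \<Rightarrow> 'h"
    and \<Delta> :: "'h \<Rightarrow> ('k, 'h, 'h) tensor"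
    and \<epsilon> :: "'h \<Rightarrow> 'k"
    and scaleV :: "'k \<Rightarrow> 'v::ab_group_add \<Rightarrow> 'v" +
  fixes \<rho> :: "'v \<Rightarrow> ('k, 'h, 'v) tensor"
  assumes coact_in_tensor: "\<rho> v \<in> tensor_space scaleH scaleV UNIV UNIV"
    and coact_linear: "Vector_Spaces.linear scaleV tscale \<rho>"
    and coact_coassoc:
      "comult_tensor_id scaleH scaleV \<Delta> (\<rho> v) = id_tensor_coact scaleH scaleV \<rho> (\<rho> v)"
    and coact_counit: "tensor_lift scaleH scaleV (\<lambda>h w. scaleV (\<epsilon> h) w) (\<rho> v) = v"
begin

definition subcomodule :: "'v set \<Rightarrow> bool" where
  "subcomodule W \<longleftrightarrow> V.subspace W \<and> \<rho> ` W \<subseteq> tensor_space scaleH scaleV UNIV W"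

end

section \<open>Hopf algebras and comodule algebras\<close>

locale unital_algebra = vector_space scale
  for scale :: "'k::field \<Rightarrow> 'a::ring_1 \<Rightarrow> 'a" +
  assumes scale_mult_left: "scale c x * y = scale c (x * y)"
    and scale_mult_right: "x * scale c y = scale c (x * y)"
begin

definition subalgebra :: "'a set \<Rightarrow> bool" where
  "subalgebra A \<longleftrightarrow> subspace A \<and> 1 \<in> A \<and> (\<forall>x\<in>A. \<forall>y\<in>A. x * y \<in> A)"

end

text \<open>\<open>(a \<otimes> b)(c \<otimes> d) = ac \<otimes> bd\<close>\<close>

definition tensor_mult ::
    "('k::field \<Rightarrow> 'a::ring_1 \<Rightarrow> 'a) \<Rightarrow> ('k \<Rightarrow> 'b::ring_1 \<Rightarrow> 'b) \<Rightarrow>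
     ('k, 'a, 'b) tensor \<Rightarrow> ('k, 'a, 'b) tensor \<Rightarrow> ('k, 'a, 'b) tensor" where
  "tensor_mult s1 s2 T S =
     tensor_lift s1 s2 (\<lambda>a b. tensor_lift s1 s2 (\<lambda>c d. tens s1 s2 (a * c) (b * d)) S) T"

locale hopf_algebra = coalgebra scale \<Delta> \<epsilon> + unital_algebra scale
  for scale :: "'k::field \<Rightarrow> 'h::ring_1 \<Rightarrow> 'h"
    and \<Delta> :: "'h \<Rightarrow> ('k, 'h, 'h) tensor"
    and \<epsilon> :: "'h \<Rightarrow> 'k" +
  fixes S :: "'h \<Rightarrow> 'h"
  assumes comult_one: "\<Delta> 1 = tens scale scale 1 1"
    and comult_mult: "\<Delta> (x * y) = tensor_mult scale scale (\<Delta> x) (\<Delta> y)"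
    and counit_one: "\<epsilon> 1 = 1"
    and counit_mult: "\<epsilon> (x * y) = \<epsilon> x * \<epsilon> y"
    and antipode_linear: "Vector_Spaces.linear scale scale S"
    and antipode_left: "tensor_lift scale scale (\<lambda>a b. S a * b) (\<Delta> x) = scale (\<epsilon> x) 1"
    and antipode_right: "tensor_lift scale scale (\<lambda>a b. a * S b) (\<Delta> x) = scale (\<epsilon> x) 1"

definition right_ideal :: "'b::ring_1 set \<Rightarrow> bool" where
  "right_ideal I \<longleftrightarrow>
     0 \<in> I \<and> (\<forall>x\<in>I. \<forall>y\<in>I. x + y \<in> I) \<and> (\<forall>x\<in>I. - x \<in> I) \<and> (\<forall>x\<in>I. \<forall>b. x * b \<in> I)"

locale comodule_algebra =
  H: hopf_algebra scaleH \<Delta> \<epsilon> S + left_comodule scaleH \<Delta> \<epsilon> scaleB \<rho> + B: unital_algebra scaleB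
  for scaleH :: "'k::field \<Rightarrow> 'h::ring_1 \<Rightarrow> 'h"
    and \<Delta> :: "'h \<Rightarrow> ('k, 'h, 'h) tensor"
    and \<epsilon> :: "'h \<Rightarrow> 'k"
    and S :: "'h \<Rightarrow> 'h"
    and scaleB :: "'k \<Rightarrow> 'b::ring_1 \<Rightarrow> 'b"
    and \<rho> :: "'b \<Rightarrow> ('k, 'h, 'b) tensor" +
  assumes coact_one: "\<rho> 1 = tens scaleH scaleB 1 1"
    and coact_mult: "\<rho> (x * y) = tensor_mult scaleH scaleB (\<rho> x) (\<rho> y)"
begin

text \<open>The first conjunct already follows from the class \<^class>\<open>ring_1\<close>.\<close>

definition right_H_simple :: bool where
  "right_H_simple \<longleftrightarrow>
     (UNIV :: 'b set) \<noteq> {0} \<and> (\<forall>I. right_ideal I \<and> subcomodule I \<longrightarrow> I = {0} \<or> I = UNIV)"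

definition comodule_subalgebra :: "'b set \<Rightarrow> bool" where
  "comodule_subalgebra A \<longleftrightarrow> B.subalgebra A \<and> subcomodule A"

definition finite_dim :: "'b set \<Rightarrow> bool" where
  "finite_dim W \<longleftrightarrow> (\<exists>F. finite F \<and> V.span F = W)"

end

section \<open>Freeness over a subring\<close>

definition right_module_basis :: "'b::ring_1 set \<Rightarrow> 'b set \<Rightarrow> bool" where
  "right_module_basis A X \<longleftrightarrow>
     (\<forall>b. \<exists>F c. finite F \<and> F \<subseteq> X \<and> (\<forall>x\<in>F. c x \<in> A) \<and> b = (\<Sum>x\<in>F. x * c x)) \<and>
     (\<forall>F c. finite F \<and> F \<subseteq> X \<and> (\<forall>x\<in>F. c x \<in> A) \<and> (\<Sum>x\<in>F. x * c x) = 0 \<longrightarrow> (\<forall>x\<in>F. c x = 0))"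

text \<open>The whole ring \<open>'b\<close> is free as a right module over its subring \<open>A\<close>.\<close>

definition free_right_module :: "'b::ring_1 set \<Rightarrow> bool" where
  "free_right_module A \<longleftrightarrow> (\<exists>X. right_module_basis A X)"

end

theory Submission
  imports Defs
begin

text \<open>
  Over a pointed coalgebra, every nonzero quotient \<open>N / M\<close> of subcomodules contains a
  semi-invariant: an \<open>m\<close> outside \<open>M\<close> with \<open>\<rho> m = g \<otimes> m\<close> modulo \<open>H \<otimes> M\<close> for a grouplike \<open>g\<close>. Since \<open>g\<close> is
  invertible, annihilators of semi-invariants are subcomodules. If \<open>B\<close> is right \<open>H\<close>-simple, a
  semi-invariant \<open>b \<noteq> 0\<close> of \<open>A\<close> therefore has right annihilator \<open>0\<close>, and \<open>b * A = A\<close> as \<open>A\<close> is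
  finite-dimensional; so \<open>A\<close> has no proper nonzero right ideal that is a subcomodule. Hence for a
  right \<open>A\<close>-submodule and subcomodule \<open>M\<close> of \<open>B\<close> and a semi-invariant \<open>m\<close> of \<open>B / M\<close>, the map
  \<open>a \<mapsto> m * a\<close> embeds \<open>A\<close> in \<open>B / M\<close>, and \<open>B\<close> is exhausted by extensions with factors \<open>A\<close>.
\<close>

section \<open>Tensors and their slices\<close>

abbreviation linear_form :: "('k::field \<Rightarrow> 'v::ab_group_add \<Rightarrow> 'v) \<Rightarrow> ('v \<Rightarrow> 'k) \<Rightarrow> bool" where
  "linear_form s f \<equiv> Vector_Spaces.linear s (*) f"

lemma vector_space_mult: "vector_space ((*) :: 'k::field \<Rightarrow> 'k \<Rightarrow> 'k)"
  by unfold_locales (auto simp: algebra_simps)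

lemma linear_props:
  assumes "Vector_Spaces.linear s t f"
  shows "f (x + y) = f x + f y" "f (s c x) = t c (f x)" "f 0 = 0" "f (x - y) = f x - f y"
    "vector_space s" "vector_space t"
proof -
  from assms have "module_hom s t f" by (simp add: linear_iff_module_hom)
  then show "f (x + y) = f x + f y" "f (s c x) = t c (f x)" "f 0 = 0" "f (x - y) = f x - f y"
    by (simp_all add: module_hom.add module_hom.scale module_hom.zero module_hom.diff)
  show "vector_space s" "vector_space t" using assms by (simp_all add: Vector_Spaces.linear_def)
qed

lemma linearI:
  assumes "vector_space s" "vector_space t"
    and "\<And>x y. f (x + y) = f x + f y" "\<And>c x. f (s c x) = t c (f x)"
  shows "Vector_Spaces.linear s t f"
  using assms by (simp add: Vector_Spaces.linear_iff vector_space_pair_def)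

lemma bilinear_mapI:
  assumes "vector_space s1" "vector_space s2" "vector_space s3"
    and "\<And>x y w. f (x + y) w = f x w + f y w" "\<And>c x w. f (s1 c x) w = s3 c (f x w)"
    and "\<And>v x y. f v (x + y) = f v x + f v y" "\<And>v c x. f v (s2 c x) = s3 c (f v x)"
  shows "bilinear_map s1 s2 s3 f"
  unfolding bilinear_map_def using assms by (auto intro!: linearI)

lemma bilinear_map_props:
  assumes "bilinear_map s1 s2 s3 f"
  shows "f (x + y) w = f x w + f y w" "f (s1 c x) w = s3 c (f x w)" "f 0 w = 0"
    "f v (w + z) = f v w + f v z" "f v (s2 c w) = s3 c (f v w)" "f v 0 = 0"
proof -
  have l: "Vector_Spaces.linear s1 s3 (\<lambda>v. f v w)" and r: "Vector_Spaces.linear s2 s3 (f v)" for v w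
    using assms by (simp_all add: bilinear_map_def)
  show "f (x + y) w = f x w + f y w" "f (s1 c x) w = s3 c (f x w)" "f 0 w = 0"
    "f v (w + z) = f v w + f v z" "f v (s2 c w) = s3 c (f v w)" "f v 0 = 0"
    using linear_props(1-3)[OF l] linear_props(1-3)[OF r] by blast+
qed

lemma linear_sum_list:
  assumes "Vector_Spaces.linear s t f"
  shows "f (\<Sum>x\<leftarrow>xs. g x) = (\<Sum>x\<leftarrow>xs. f (g x))"
  by (induction xs) (simp_all add: linear_props[OF assms])

lemma linear_sum:
  assumes "Vector_Spaces.linear s t f"
  shows "f (\<Sum>x\<in>F. g x) = (\<Sum>x\<in>F. f (g x))"
  by (induction F rule: infinite_finite_induct) (simp_all add: linear_props[OF assms])

lemma tens_in_tensor_space: "v \<in> V \<Longrightarrow> w \<in> W \<Longrightarrow> tens s1 s2 v w \<in> tensor_space s1 s2 V W"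
  unfolding tensor_space_def
  by (rule module.span_base) (use vector_space_tscale in \<open>auto simp: module_iff_vector_space\<close>)

lemma subspace_tensor_space: "module.subspace tscale (tensor_space s1 s2 V W)"
  unfolding tensor_space_def
  by (rule module.subspace_span) (use vector_space_tscale in \<open>auto simp: module_iff_vector_space\<close>)

lemma tensor_space_sum:
  assumes "\<And>x. x \<in> F \<Longrightarrow> T x \<in> tensor_space s1 s2 V W"
  shows "sum T F \<in> tensor_space s1 s2 V W"
  by (rule module.subspace_sum[OF _ subspace_tensor_space])
     (use vector_space_tscale assms in \<open>auto simp: module_iff_vector_space\<close>)

lemma tensor_space_sum_listE:
  assumes "vector_space s1" "vector_space s2" "module.subspace s1 V"
    and "T \<in> tensor_space s1 s2 V W"
  obtains xs where "T = (\<Sum>(v, w)\<leftarrow>xs. tens s1 s2 v w)" "set xs \<subseteq> V \<times> W"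
proof -
  interpret v1: vector_space s1 by fact
  interpret t: vector_space tscale by (rule vector_space_tscale)
  have "\<exists>xs. T = (\<Sum>(v, w)\<leftarrow>xs. tens s1 s2 v w) \<and> set xs \<subseteq> V \<times> W"
    using assms(4) unfolding tensor_space_def
  proof (induction rule: t.span_induct_alt)
    case base
    show ?case by (rule exI[of _ "[]"]) simp
  next
    case (step c x y)
    from step obtain v w xs where
      x: "x = tens s1 s2 v w" "v \<in> V" "w \<in> W"
      and y: "y = (\<Sum>(v, w)\<leftarrow>xs. tens s1 s2 v w)" "set xs \<subseteq> V \<times> W" by auto
    have "tscale c (tens s1 s2 v w) = tens s1 s2 (s1 c v) w"
      using bilinear_map_scale_left[OF bilinear_map_tens[OF assms(1,2)]] by metis
    then show ?case
      by (intro exI[of _ "(s1 c v, w) # xs"]) (auto simp: x y v1.subspace_scale[OF assms(3)])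
  qed
  then show thesis using that by blast
qed

text \<open>Products in \<open>H \<otimes> B\<close> are lifts nested in lifts, and the outer lift
  needs a bilinear integrand. Writing \<open>T\<close> as a finite sum of pure tensors turns the
  inner lift into a finite sum of maps bilinear in \<open>a\<close> and \<open>b\<close>.\<close>

lemma bilinear_map_tensor_lift:
  assumes T: "T \<in> tensor_space s1 s2 UNIV UNIV"
    and F1: "\<And>a b. bilinear_map s1 s2 s5 (F a b)"
    and F2: "\<And>c d. bilinear_map s3 s4 s5 (\<lambda>a b. F a b c d)"
  shows "bilinear_map s3 s4 s5 (\<lambda>a b. tensor_lift s1 s2 (F a b) T)"
proof -
  have vs: "vector_space s1" "vector_space s2" "vector_space s3" "vector_space s4" "vector_space s5"
    using F1 F2 by (auto simp: bilinear_map_def Vector_Spaces.linear_def)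
  interpret v5: vector_space s5 by fact
  obtain xs where T: "T = (\<Sum>(v, w)\<leftarrow>xs. tens s1 s2 v w)"
    using T tensor_space_sum_list[OF vs(1,2)] by metis
  have "bilinear_map s3 s4 s5 (\<lambda>a b. (\<Sum>(c, d)\<leftarrow>xs. F a b c d))"
    by (intro bilinear_mapI vs; induction xs)
       (auto simp: bilinear_map_props[OF F2] v5.scale_right_distrib)
  then show ?thesis by (simp add: T tensor_lift_sum_list[OF F1])
qed

section \<open>Slices: contraction of one tensor factor with a linear form\<close>

definition lslice ::
    "('k::field \<Rightarrow> 'v::ab_group_add \<Rightarrow> 'v) \<Rightarrow> ('k \<Rightarrow> 'w::ab_group_add \<Rightarrow> 'w) \<Rightarrow>
     ('v \<Rightarrow> 'k) \<Rightarrow> ('k, 'v, 'w) tensor \<Rightarrow> 'w" where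
  "lslice s1 s2 f = tensor_lift s1 s2 (\<lambda>v w. s2 (f v) w)"

definition rslice ::
    "('k::field \<Rightarrow> 'v::ab_group_add \<Rightarrow> 'v) \<Rightarrow> ('k \<Rightarrow> 'w::ab_group_add \<Rightarrow> 'w) \<Rightarrow>
     ('w \<Rightarrow> 'k) \<Rightarrow> ('k, 'v, 'w) tensor \<Rightarrow> 'v" where
  "rslice s1 s2 f = tensor_lift s1 s2 (\<lambda>v w. s1 (f w) v)"

lemma bilinear_map_lslice:
  assumes "linear_form s1 f" "vector_space s2"
  shows "bilinear_map s1 s2 s2 (\<lambda>v w. s2 (f v) w)"
proof -
  interpret vector_space s2 by fact
  show ?thesis
    by (rule bilinear_mapI) (use linear_props[OF assms(1)] assms(2) in
      \<open>auto simp: scale_left_distrib scale_right_distrib mult.commute\<close>)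
qed

lemma bilinear_map_rslice:
  assumes "linear_form s2 f" "vector_space s1"
  shows "bilinear_map s1 s2 s1 (\<lambda>v w. s1 (f w) v)"
proof -
  interpret vector_space s1 by fact
  show ?thesis
    by (rule bilinear_mapI) (use linear_props[OF assms(1)] assms(2) in
      \<open>auto simp: scale_left_distrib scale_right_distrib mult.commute\<close>)
qed

lemmas lslice_sum_list =
  tensor_lift_sum_list[OF bilinear_map_lslice, folded lslice_def]
lemmas rslice_sum_list =
  tensor_lift_sum_list[OF bilinear_map_rslice, folded rslice_def]
lemmas lslice_tens = tensor_lift_tens[OF bilinear_map_lslice, folded lslice_def]
lemmas lslice_add = tensor_lift_add[OF bilinear_map_lslice, folded lslice_def]
lemmas lslice_scale = tensor_lift_scale[OF bilinear_map_lslice, folded lslice_def]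
lemmas rslice_add = tensor_lift_add[OF bilinear_map_rslice, folded rslice_def]
lemmas rslice_scale = tensor_lift_scale[OF bilinear_map_rslice, folded rslice_def]

text \<open>Both sides are \<open>f \<otimes> \<phi>\<close> applied to \<open>T\<close>.\<close>

lemma lslice_rslice:
  assumes f: "linear_form s1 f" and \<phi>: "linear_form s2 \<phi>"
    and T: "T \<in> tensor_space s1 s2 UNIV UNIV"
  shows "\<phi> (lslice s1 s2 f T) = f (rslice s1 s2 \<phi> T)"
proof -
  note vs = linear_props(5)[OF f] linear_props(5)[OF \<phi>]
  obtain xs where "T = (\<Sum>(v, w)\<leftarrow>xs. tens s1 s2 v w)"
    using T tensor_space_sum_list[OF vs] by metis
  then show ?thesis
    by (simp only: lslice_sum_list[OF f vs(2)] rslice_sum_list[OF \<phi> vs(1)]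
        linear_sum_list[OF f] linear_sum_list[OF \<phi>])
       (simp add: case_prod_unfold linear_props(2)[OF f] linear_props(2)[OF \<phi>] mult.commute)
qed

lemma linear_form_representation:
  assumes "vector_space s" "\<not> module.dependent s X" "module.span s X = UNIV"
  shows "linear_form s (\<lambda>v. module.representation s X v b)"
proof -
  interpret vector_space s by fact
  show ?thesis using assms
    by (intro linearI) (auto simp: vector_space_mult representation_add representation_scale)
qed

text \<open>A basis of \<open>M\<close> stays independent after adding \<open>x\<close>; the form is
  the coordinate at \<open>x\<close> in a basis of the whole space that extends it.\<close>

lemma linear_form_separates_subspace:
  assumes "vector_space s" "module.subspace s M" "x \<notin> M"
  obtains \<phi> where "linear_form s \<phi>" "\<And>m. m \<in> M \<Longrightarrow> \<phi> m = 0" "\<phi> x = 1"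
proof -
  interpret vector_space s by fact
  obtain X where X: "X \<subseteq> M" "independent X" "M \<subseteq> span X" using maximal_independent_subset by metis
  have "span X = M" using X assms(2) by (metis span_minimal subset_antisym)
  then have ind: "independent (insert x X)" using X(2) assms(3) independent_insertI by metis
  obtain Y where Y: "insert x X \<subseteq> Y" "independent Y" "span Y = UNIV"
    using maximal_independent_subset_extend[OF subset_UNIV ind] by (metis top.extremum_uniqueI)
  have "x \<notin> X" using X(1) assms(3) by blast
  have "representation Y m x = 0" if "m \<in> M" for m
    using representation_extend[of Y m X] X Y \<open>x \<notin> X\<close> that
    by (metis representation_ne_zero insert_subset subsetD)
  moreover have "representation Y x x = 1" using representation_basis[OF Y(2), of x] Y(1) by simp
  ultimately show thesis
    using that linear_form_representation[OF assms(1) Y(2,3)] by blast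
qed

text \<open>Linear forms separate points, in any dimension. This lets later identities between
  vectors be checked after pairing with a form, where left and right slices can be
  exchanged.\<close>

lemma linear_form_eqI:
  assumes "vector_space s" "\<And>\<phi>. linear_form s \<phi> \<Longrightarrow> \<phi> x = \<phi> y"
  shows "x = y"
proof (rule ccontr)
  interpret vector_space s by fact
  assume "x \<noteq> y"
  then obtain \<phi> where "linear_form s \<phi>" "\<phi> (x - y) = 1"
    using linear_form_separates_subspace[OF assms(1) subspace_single_0, of "x - y"] by auto
  then show False using assms(2)[of \<phi>] linear_props(4)[of s "(*)" \<phi> x y] by simp
qed

text \<open>The set \<open>F\<close> may exceed the support of \<open>h\<close>, so that one
  \<open>F\<close> can serve all left factors of a sum at once.\<close>

lemma tens_expand:
  assumes "vector_space s1" "vector_space s2"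
    and X: "\<not> module.dependent s1 X" "module.span s1 X = UNIV"
    and F: "finite F" "{b. module.representation s1 X h b \<noteq> 0} \<subseteq> F"
  shows "tens s1 s2 h v = (\<Sum>b\<in>F. tens s1 s2 b (s2 (module.representation s1 X h b) v))"
proof -
  interpret vector_space s1 by fact
  note bt = bilinear_map_tens[OF assms(1,2)]
  have l: "Vector_Spaces.linear s1 tscale (\<lambda>h. tens s1 s2 h v)"
    using bt by (simp add: bilinear_map_def)
  have "h = (\<Sum>b\<in>F. s1 (representation X h b) b)"
    using sum_nonzero_representation_eq[of X h] X F
    by (subst sum.mono_neutral_right[of F "{b. representation X h b \<noteq> 0}"]) auto
  then have "tens s1 s2 h v = tens s1 s2 (\<Sum>b\<in>F. s1 (representation X h b) b) v" by simp
  also have "\<dots> = (\<Sum>b\<in>F. tens s1 s2 b (s2 (representation X h b) v))"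
    by (simp only: linear_sum[OF l] bilinear_map_props[OF bt])
  finally show ?thesis .
qed

text \<open>The coefficients of \<open>T\<close> along a basis of the left factor are its slices by
  the coordinate forms. Finitely many basis vectors suffice, namely those occurring in the left
  factors of one presentation of \<open>T\<close>.\<close>

lemma tensor_expand:
  assumes vs: "vector_space s1" "vector_space s2"
    and X: "\<not> module.dependent s1 X" "module.span s1 X = UNIV"
    and T: "T \<in> tensor_space s1 s2 UNIV UNIV"
  obtains F where "finite F" "F \<subseteq> X"
    "T = (\<Sum>b\<in>F. tens s1 s2 b (lslice s1 s2 (\<lambda>h. module.representation s1 X h b) T))"
proof -
  interpret v1: vector_space s1 by fact
  obtain xs where xs: "T = (\<Sum>(v, w)\<leftarrow>xs. tens s1 s2 v w)"
    using T tensor_space_sum_list[OF vs] by metis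
  define F where "F = (\<Union>(h, v)\<in>set xs. {b. v1.representation X h b \<noteq> 0})"
  have F: "finite F" unfolding F_def by (auto simp: v1.finite_representation)
  have FX: "F \<subseteq> X" unfolding F_def by (auto simp: v1.representation_ne_zero)
  note bt = bilinear_map_tens[OF vs]
  note lin = linear_form_representation[OF vs(1) X]
  have l: "Vector_Spaces.linear s2 tscale (tens s1 s2 b)" for b
    using bt by (simp add: bilinear_map_def)
  have "(\<Sum>(v, w)\<leftarrow>ys. tens s1 s2 v w) =
      (\<Sum>b\<in>F. tens s1 s2 b (\<Sum>(h, v)\<leftarrow>ys. s2 (v1.representation X h b) v))"
    if "set ys \<subseteq> set xs" for ys
    using that
  proof (induction ys)
    case Nil
    show ?case using bilinear_map_props[OF bt] by simp
  next
    case (Cons p ys)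
    obtain h v where p: "p = (h, v)" by force
    then have "{b. v1.representation X h b \<noteq> 0} \<subseteq> F" using Cons.prems unfolding F_def by auto
    then show ?case
      using Cons tens_expand[OF vs X F, of h v]
      by (simp add: p bilinear_map_props[OF bt] sum.distrib del: plus_fun_apply)
  qed
  from this[of xs] show thesis
    using that F FX unfolding xs lslice_sum_list[OF lin vs(2)] by blast
qed

text \<open>In the expansion along a basis every right factor is a slice, hence in \<open>W\<close>.
  This is the converse of \<open>lslice_in_subspace\<close>.\<close>

lemma tensor_space_left_slices:
  assumes "vector_space s1" "vector_space s2" "T \<in> tensor_space s1 s2 UNIV UNIV"
    and "\<And>f. linear_form s1 f \<Longrightarrow> lslice s1 s2 f T \<in> W"
  shows "T \<in> tensor_space s1 s2 UNIV W"
proof -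
  interpret v1: vector_space s1 by fact
  obtain X where X: "v1.independent X" "v1.span X = UNIV"
    using v1.maximal_independent_subset[of UNIV] by (metis top.extremum_uniqueI)
  obtain F where F: "T = (\<Sum>b\<in>F. tens s1 s2 b (lslice s1 s2 (\<lambda>h. v1.representation X h b) T))"
    using tensor_expand[OF assms(1,2) X assms(3)] by metis
  show ?thesis
    by (subst F) (intro tensor_space_sum tens_in_tensor_space UNIV_I assms(4)
        linear_form_representation[OF assms(1) X])
qed

text \<open>This is how subcoalgebras are recognised: \<open>\<Delta> d\<close> has to be placed in
  \<open>D \<otimes> D\<close>. In a basis extending a basis \<open>Y\<close> of \<open>D\<close>,
  the coefficients of \<open>T\<close> outside \<open>Y\<close> vanish, since
  \<open>lslice_rslice\<close> turns them into coordinates of right slices, which lie in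
  \<open>D\<close>.\<close>

lemma tensor_space_slices:
  assumes "vector_space s1" "vector_space s2" "T \<in> tensor_space s1 s2 UNIV UNIV"
    and D: "module.subspace s1 D"
    and l: "\<And>f. linear_form s1 f \<Longrightarrow> lslice s1 s2 f T \<in> E"
    and r: "\<And>f. linear_form s2 f \<Longrightarrow> rslice s1 s2 f T \<in> D"
  shows "T \<in> tensor_space s1 s2 D E"
proof -
  interpret v1: vector_space s1 by fact
  interpret v2: vector_space s2 by fact
  obtain Y where Y: "Y \<subseteq> D" "v1.independent Y" "D \<subseteq> v1.span Y"
    using v1.maximal_independent_subset by metis
  obtain X where X: "Y \<subseteq> X" "v1.independent X" "v1.span X = UNIV"
    using v1.maximal_independent_subset_extend[OF subset_UNIV Y(2)] by (metis top.extremum_uniqueI)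
  note lin = linear_form_representation[OF assms(1) X(2,3)]
  have zero: "lslice s1 s2 (\<lambda>h. v1.representation X h b) T = 0" if "b \<notin> Y" for b
  proof (rule linear_form_eqI[OF assms(2)])
    fix \<phi> assume \<phi>: "linear_form s2 \<phi>"
    have "rslice s1 s2 \<phi> T \<in> v1.span Y" using r[OF \<phi>] Y(3) by blast
    then have "v1.representation X (rslice s1 s2 \<phi> T) b = 0"
      using v1.representation_extend[OF X(2) _ X(1)] that by (metis v1.representation_ne_zero)
    then show "\<phi> (lslice s1 s2 (\<lambda>h. v1.representation X h b) T) = \<phi> 0"
      using lslice_rslice[OF lin \<phi> assms(3)] linear_props(3)[OF \<phi>] by simp
  qed
  obtain F where F: "T = (\<Sum>b\<in>F. tens s1 s2 b (lslice s1 s2 (\<lambda>h. v1.representation X h b) T))"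
    using tensor_expand[OF assms(1,2) X(2,3) assms(3)] by metis
  have "tens s1 s2 b (lslice s1 s2 (\<lambda>h. v1.representation X h b) T) \<in> tensor_space s1 s2 D E" for b
  proof (cases "b \<in> Y")
    case True
    then show ?thesis using Y(1) l[OF lin] by (intro tens_in_tensor_space) auto
  next
    case False
    have "tens s1 s2 b (lslice s1 s2 (\<lambda>h. v1.representation X h b) T) = tens s1 s2 0 0"
      using bilinear_map_props(3,6)[OF bilinear_map_tens[OF assms(1,2)]] by (simp add: zero[OF False])
    also have "\<dots> \<in> tensor_space s1 s2 D E"
      \<comment> \<open>\<open>E\<close> is only a set, so slicing with the zero form supplies an
        element of it; its tensor with \<open>0\<close> is the zero tensor.\<close>
      using v1.subspace_0[OF D] l[of "\<lambda>_. 0"]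
        tens_in_tensor_space[of 0 D "lslice s1 s2 (\<lambda>_. 0) T" E s1 s2]
        linearI[OF assms(1) vector_space_mult, of "\<lambda>_. 0"]
      by (simp add: bilinear_map_props(3,6)[OF bilinear_map_tens[OF assms(1,2)]] v2.scale_zero_left)
    finally show ?thesis .
  qed
  then show ?thesis by (subst F) (rule tensor_space_sum)
qed

lemma lslice_in_subspace:
  assumes "vector_space s1" "vector_space s2" "module.subspace s2 W" "linear_form s1 f"
    and "T \<in> tensor_space s1 s2 UNIV W"
  shows "lslice s1 s2 f T \<in> W"
proof -
  interpret v1: vector_space s1 by fact
  interpret v2: vector_space s2 by fact
  obtain xs where xs: "T = (\<Sum>(v, w)\<leftarrow>xs. tens s1 s2 v w)" "set xs \<subseteq> UNIV \<times> W"
    using tensor_space_sum_listE[OF assms(1,2) v1.subspace_UNIV assms(5)] by metis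
  have "(\<Sum>(v, w)\<leftarrow>xs. s2 (f v) w) \<in> W"
    using xs(2) by (induction xs)
      (auto simp: v2.subspace_0[OF assms(3)] intro!: v2.subspace_add v2.subspace_scale assms(3))
  then show ?thesis by (simp add: xs(1) lslice_sum_list[OF assms(4,2)])
qed

lemma tensor_space_sum_listI:
  assumes "\<And>x. x \<in> set xs \<Longrightarrow> T x \<in> tensor_space s1 s2 V W"
  shows "(\<Sum>x\<leftarrow>xs. T x) \<in> tensor_space s1 s2 V W"
proof -
  have m: "module tscale" using vector_space_tscale by (simp add: module_iff_vector_space)
  note sub = subspace_tensor_space
  show ?thesis using assms
    by (induction xs) (auto simp: module.subspace_0[OF m sub] simp del: plus_fun_apply
      intro!: module.subspace_add[OF m sub])
qed

lemma tensor_lift_sum: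
  assumes f: "bilinear_map s1 s2 s3 f"
    and "\<And>x. x \<in> set xs \<Longrightarrow> T x \<in> tensor_space s1 s2 UNIV UNIV"
  shows "tensor_lift s1 s2 f (\<Sum>x\<leftarrow>xs. T x) = (\<Sum>x\<leftarrow>xs. tensor_lift s1 s2 f (T x))"
  using assms(2)
proof (induction xs)
  case Nil
  show ?case using tensor_lift_sum_list[OF f, of "[]"] by (simp only: list.map sum_list.Nil)
next
  case (Cons x xs)
  have "(\<Sum>x\<leftarrow>xs. T x) \<in> tensor_space s1 s2 UNIV UNIV"
    by (rule tensor_space_sum_listI) (use Cons in auto)
  then show ?case using Cons by (simp add: tensor_lift_add[OF f] del: plus_fun_apply)
qed

lemma tensor_mult_sum_list:
  assumes "unital_algebra s1" "unital_algebra s2"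
  shows "tensor_mult s1 s2 (\<Sum>(a, b)\<leftarrow>xs. tens s1 s2 a b) (\<Sum>(c, d)\<leftarrow>ys. tens s1 s2 c d) =
    (\<Sum>(a, b)\<leftarrow>xs. \<Sum>(c, d)\<leftarrow>ys. tens s1 s2 (a * c) (b * d))"
proof -
  interpret u1: unital_algebra s1 by fact
  interpret u2: unital_algebra s2 by fact
  note vs = u1.vector_space_axioms u2.vector_space_axioms vector_space_tscale
  note bt = bilinear_map_tens[OF vs(1,2)]
  have b1: "bilinear_map s1 s2 tscale (\<lambda>c d. tens s1 s2 (a * c) (b * d))" for a b
    by (rule bilinear_mapI[OF vs])
       (simp_all only: bilinear_map_props[OF bt] distrib_left u1.scale_mult_right u2.scale_mult_right)
  have b2: "bilinear_map s1 s2 tscale (\<lambda>a b. tens s1 s2 (a * c) (b * d))" for c d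
    by (rule bilinear_mapI[OF vs])
       (simp_all only: bilinear_map_props[OF bt] distrib_right u1.scale_mult_left u2.scale_mult_left)
  have "(\<Sum>(c, d)\<leftarrow>ys. tens s1 s2 c d) \<in> tensor_space s1 s2 UNIV UNIV"
    by (rule tensor_space_sum_listI) (auto intro: tens_in_tensor_space)
  from bilinear_map_tensor_lift[OF this b1 b2] show ?thesis
    unfolding tensor_mult_def by (simp only: tensor_lift_sum_list tensor_lift_sum_list[OF b1])
qed

section \<open>Semi-invariants in comodules over pointed coalgebras\<close>

text \<open>A member of least dimension is minimal: a basis of a smaller member extends to a basis
  of \<open>E\<close>, which has no more elements. With \<open>P\<close> general, the argument
  yields both simple subcoalgebras and minimal stable subspaces not inside \<open>M\<close>.\<close>

lemma (in vector_space) minimal_finite_dim_subspace: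
  assumes "finite F" "E0 \<subseteq> span F" "P E0" "\<forall>E. P E \<longrightarrow> subspace E"
  shows "\<exists>E\<subseteq>E0. P E \<and> (\<forall>E'\<subseteq>E. P E' \<longrightarrow> E' = E)"
proof -
  have fin: "finite X \<and> card X \<le> card F" if "independent X" "X \<subseteq> E" "E \<subseteq> E0" for X E
    using independent_span_bound[OF assms(1) that(1)] that(2,3) assms(2) by (meson order_trans)
  let ?Q = "\<lambda>E. P E \<and> E \<subseteq> E0"
  obtain E where E: "?Q E" "\<And>E'. ?Q E' \<Longrightarrow> dim E \<le> dim E'"
    using ex_has_least_nat[of ?Q E0 dim] assms(3) by blast
  have "E' = E" if E': "P E'" "E' \<subseteq> E" for E'
  proof -
    obtain X where X: "X \<subseteq> E'" "independent X" "E' \<subseteq> span X" "card X = dim E'"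
      using basis_exists by metis
    obtain Y where Y: "X \<subseteq> Y" "Y \<subseteq> E" "independent Y" "E \<subseteq> span Y"
      using maximal_independent_subset_extend[of X E] X E' by (metis order_trans)
    have "card Y = dim E" using Y by (simp add: basis_card_eq_dim)
    moreover have "finite Y" using fin Y E(1) by blast
    moreover have "dim E \<le> dim E'" using E E' by blast
    ultimately have "X = Y" using X(4) Y(1) by (simp add: card_seteq)
    then have "E \<subseteq> E'" using Y(4) X(1) E'(1) assms(4) span_minimal by blast
    then show ?thesis using E'(2) by blast
  qed
  then show ?thesis using E(1) by (intro exI[of _ E]) simp
qed

section \<open>Slices of the comultiplication, and grouplikes in pointed coalgebras\<close>

context coalgebra
begin

text \<open>The inner tensor is the image of \<open>x \<otimes> w\<close> under
  \<open>comult_tensor_id\<close>; slicing its first factor leaves the second leg of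
  \<open>\<Delta> x\<close> next to \<open>w\<close>. The membership allows sums of such tensors to
  be sliced termwise.\<close>

lemma tensor_lift_comult_lslice:
  assumes f: "linear_form scale f" and s: "vector_space s"
  shows "lslice scale tscale f (tensor_lift scale scale
      (\<lambda>a b. tens scale tscale a (tens scale s b w)) (\<Delta> x)) = tens scale s (lslice scale scale f (\<Delta> x)) w" (is ?eq)
    and "tensor_lift scale scale (\<lambda>a b. tens scale tscale a (tens scale s b w)) (\<Delta> x)
      \<in> tensor_space scale tscale UNIV UNIV" (is ?mem)
proof -
  note vs = vector_space_axioms
  obtain xs where xs: "\<Delta> x = (\<Sum>(v, w)\<leftarrow>xs. tens scale scale v w)"
    using tensor_space_sum_list[OF vs vs comult_in_tensor] by metis
  note b1 = bilinear_map_tens[OF vs s]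
    and b2 = bilinear_map_tens[OF vs vector_space_tscale]
  have b: "bilinear_map scale scale tscale (\<lambda>a b. tens scale tscale a (tens scale s b w))"
    by (rule bilinear_mapI[OF vs vs vector_space_tscale])
       (simp_all only: bilinear_map_props[OF b1] bilinear_map_props[OF b2])
  have l: "Vector_Spaces.linear scale tscale (\<lambda>v. tens scale s v w)"
    using b1 by (simp add: bilinear_map_def)
  show ?mem
    unfolding xs tensor_lift_sum_list[OF b]
    by (rule tensor_space_sum_listI) (auto intro: tens_in_tensor_space)
  have "lslice scale tscale f (\<Sum>(a, b)\<leftarrow>xs. tens scale tscale a (tens scale s b w)) =
      (\<Sum>(a, b)\<leftarrow>xs. tscale (f a) (tens scale s b w))"
    unfolding lslice_def
    by (subst tensor_lift_sum[OF bilinear_map_lslice[OF f vector_space_tscale]])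
       (auto simp: case_prod_unfold tens_in_tensor_space
         tensor_lift_tens[OF bilinear_map_lslice[OF f vector_space_tscale]])
  also have "\<dots> = tens scale s (\<Sum>(a, b)\<leftarrow>xs. scale (f a) b) w"
    unfolding linear_sum_list[OF l] by (simp add: case_prod_unfold bilinear_map_props(2)[OF b1])
  finally show ?eq
    by (simp only: xs tensor_lift_sum_list[OF b] lslice_sum_list[OF f vs])
qed

lemma linear_comult_lslice:
  assumes "linear_form scale f"
  shows "Vector_Spaces.linear scale scale (\<lambda>h. lslice scale scale f (\<Delta> h))"
  using linear_props[OF comult_linear] vector_space_axioms
  by (intro linearI)
     (simp_all add: lslice_add[OF assms(1)] lslice_scale[OF assms(1)] comult_in_tensor)

lemma linear_comult_rslice:
  assumes "linear_form scale f"
  shows "Vector_Spaces.linear scale scale (\<lambda>h. rslice scale scale f (\<Delta> h))"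
  using linear_props[OF comult_linear] vector_space_axioms
  by (intro linearI)
     (simp_all add: rslice_add[OF assms(1)] rslice_scale[OF assms(1)] comult_in_tensor)

text \<open>In Sweedler notation the new form is \<open>f h\<^sub>1 * f' h\<^sub>2\<close>, the
  convolution product of \<open>f\<close> and \<open>f'\<close>.\<close>

lemma linear_form_comult_lslice:
  assumes "linear_form scale f" "linear_form scale f'"
  shows "linear_form scale (\<lambda>h. f' (lslice scale scale f (\<Delta> h)))"
  using linear_props[OF linear_comult_lslice[OF assms(1)]] linear_props[OF assms(2)]
  by (intro linearI) (simp_all add: vector_space_mult)

text \<open>A minimal nonzero subcoalgebra of \<open>D\<close> is simple, hence a line spanned by
  some \<open>h\<close>. Then \<open>\<Delta> h\<close> is a multiple \<open>c\<close> of
  \<open>h \<otimes> h\<close>, and rescaling \<open>h\<close> by \<open>c\<close> makes it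
  grouplike.\<close>

lemma pointed_obtains_grouplike:
  assumes "pointed" "subcoalgebra D" "D \<noteq> {0}" "finite F" "D \<subseteq> span F"
  obtains g where "g \<in> D" "g \<noteq> 0" "\<Delta> g = tens scale scale g g"
proof -
  note vs = vector_space_axioms
  let ?P = "\<lambda>E. subcoalgebra E \<and> E \<noteq> {0}"
  have "\<exists>E\<subseteq>D. ?P E \<and> (\<forall>E'\<subseteq>E. ?P E' \<longrightarrow> E' = E)"
    by (rule minimal_finite_dim_subspace[where P = ?P, OF assms(4,5)])
       (use assms(2,3) in \<open>simp_all add: subcoalgebra_def\<close>)
  then obtain E where "E \<subseteq> D \<and> ?P E \<and> (\<forall>E'\<subseteq>E. ?P E' \<longrightarrow> E' = E)" ..
  then have E: "E \<subseteq> D" "?P E" "\<forall>E'\<subseteq>E. ?P E' \<longrightarrow> E' = E" by simp_all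
  have "simple_subcoalgebra E" unfolding simple_subcoalgebra_def using E(2,3) by auto
  then have "dim E = 1" using assms(1) by (simp add: pointed_def)
  then obtain X where X: "X \<subseteq> E" "independent X" "E \<subseteq> span X" "card X = 1"
    using basis_exists by metis
  then obtain h where h: "X = {h}" by (auto simp: card_1_singleton_iff)
  have hE: "h \<in> E" and h0: "h \<noteq> 0" using X h by auto
  have sub: "subspace E" using E by (simp add: subcoalgebra_def)
  note bt = bilinear_map_tens[OF vs vs]
  have "\<Delta> h \<in> tensor_space scale scale E E" using E(2) hE by (auto simp: subcoalgebra_def)
  then obtain xs where xs: "\<Delta> h = (\<Sum>(v, w)\<leftarrow>xs. tens scale scale v w)" "set xs \<subseteq> E \<times> E"
    using tensor_space_sum_listE[OF vs vs sub] by metis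
  interpret t: vector_space tscale by (rule vector_space_tscale)
  have "\<exists>c. (\<Sum>(v, w)\<leftarrow>xs. tens scale scale v w) = tscale c (tens scale scale h h)"
    using xs(2)
  proof (induction xs)
    case Nil
    show ?case by (rule exI[of _ 0]) (simp add: t.scale_zero_left)
  next
    case (Cons p xs)
    then obtain c where c: "(\<Sum>(v, w)\<leftarrow>xs. tens scale scale v w) = tscale c (tens scale scale h h)"
      by auto
    obtain v w where p: "p = (v, w)" by force
    then have "v \<in> span {h}" "w \<in> span {h}" using Cons.prems X(3) h by auto
    then obtain a b where "v = scale a h" "w = scale b h" by (auto simp: span_singleton)
    then have "tens scale scale v w = tscale (a * b) (tens scale scale h h)"
      by (simp add: bilinear_map_props(2,5)[OF bt])
    then have "(\<Sum>(v, w)\<leftarrow>p # xs. tens scale scale v w) = tscale (a * b + c) (tens scale scale h h)"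
      using c by (simp add: p t.scale_left_distrib del: plus_fun_apply)
    then show ?case by blast
  qed
  then obtain c where c: "\<Delta> h = tscale c (tens scale scale h h)" using xs(1) by auto
  \<comment> \<open>The counit axiom forces \<open>c * \<epsilon> h = 1\<close>, so the rescaling is
    by a nonzero scalar.\<close>
  have "h = lslice scale scale \<epsilon> (\<Delta> h)" using counit_left by (simp add: lslice_def)
  also have "\<dots> = scale (c * \<epsilon> h) h"
    unfolding c by (simp add: lslice_scale[OF counit_linear vs] tens_in_tensor_space
        lslice_tens[OF counit_linear vs])
  finally have "c \<noteq> 0" using h0 by auto
  moreover have "\<Delta> (scale c h) = tens scale scale (scale c h) (scale c h)"
    by (simp add: linear_props(2)[OF comult_linear] bilinear_map_props(2,5)[OF bt] c)
  moreover have "scale c h \<in> D" using hE E(1) subspace_scale[OF sub] by auto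
  ultimately show thesis using that h0 by simp
qed

end

section \<open>The action of linear forms on a comodule, and its matrix coefficients\<close>

context left_comodule
begin

text \<open>This makes the left comodule a right module over the convolution algebra of linear forms
  on \<open>H\<close>; conditions on tensors become conditions on vectors.\<close>

definition act :: "('h \<Rightarrow> 'k) \<Rightarrow> 'v \<Rightarrow> 'v" where
  "act f v = lslice scaleH scaleV f (\<rho> v)"

text \<open>These are the matrix coefficients of the comodule; by \<open>form_coeff\<close> they
  carry the same information as \<open>act\<close>.\<close>

definition coeff :: "('v \<Rightarrow> 'k) \<Rightarrow> 'v \<Rightarrow> 'h" where
  "coeff \<phi> v = rslice scaleH scaleV \<phi> (\<rho> v)"

definition stable :: "'v set \<Rightarrow> bool" where
  "stable W \<longleftrightarrow> V.subspace W \<and> (\<forall>f. linear_form scaleH f \<longrightarrow> act f ` W \<subseteq> W)"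

lemmas vsH = H.vector_space_axioms
lemmas vsV = V.vector_space_axioms

lemma coact_sum_list:
  obtains xs where "\<rho> v = (\<Sum>(h, w)\<leftarrow>xs. tens scaleH scaleV h w)"
  using tensor_space_sum_list[OF vsH vsV coact_in_tensor] by metis

lemma linear_act: "linear_form scaleH f \<Longrightarrow> Vector_Spaces.linear scaleV scaleV (act f)"
  unfolding act_def using linear_props[OF coact_linear]
  by (intro linearI vsV) (simp_all add: lslice_add vsV lslice_scale coact_in_tensor)

lemma linear_coeff: "linear_form scaleV \<phi> \<Longrightarrow> Vector_Spaces.linear scaleV scaleH (coeff \<phi>)"
  unfolding coeff_def using linear_props[OF coact_linear]
  by (intro linearI vsH vsV) (simp_all add: rslice_add vsH rslice_scale coact_in_tensor)

lemma form_coeff: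
  "linear_form scaleH f \<Longrightarrow> linear_form scaleV \<phi> \<Longrightarrow> f (coeff \<phi> v) = \<phi> (act f v)"
  unfolding act_def coeff_def by (simp add: lslice_rslice coact_in_tensor)

lemma act_counit: "act \<epsilon> v = v"
  using coact_counit by (simp add: act_def lslice_def)

text \<open>For a subspace \<open>W\<close>, a tensor lies in \<open>H \<otimes> W\<close> exactly
  when all its left slices lie in \<open>W\<close>; this is applied to the tensors
  \<open>\<rho> w\<close>.\<close>

lemma subcomodule_iff_stable: "subcomodule W \<longleftrightarrow> stable W"
  unfolding subcomodule_def stable_def act_def
  using lslice_in_subspace[OF vsH vsV] tensor_space_left_slices[OF vsH vsV coact_in_tensor]
  by (auto 4 3 simp: image_subset_iff)

text \<open>Coassociativity is sliced by \<open>f\<close> in its outermost \<open>H\<close>-factor: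
  the \<open>\<Delta>\<close> side gives the sum, and the \<open>\<rho>\<close> side collects to
  \<open>\<rho> (act f v)\<close>.\<close>

lemma coact_act:
  assumes f: "linear_form scaleH f" and v: "\<rho> v = (\<Sum>(h, w)\<leftarrow>xs. tens scaleH scaleV h w)"
  shows "\<rho> (act f v) = (\<Sum>(h, w)\<leftarrow>xs. tens scaleH scaleV (lslice scaleH scaleH f (\<Delta> h)) w)"
proof -
  note b1 = bilinear_map_tens[OF vsH vsV]
    and b2 = bilinear_map_tens[OF vsH vector_space_tscale]
    and vt = vector_space_tscale
  have b: "bilinear_map scaleH scaleH tscale (\<lambda>a b. tens scaleH tscale a (tens scaleH scaleV b v))" for v
    by (rule bilinear_mapI[OF vsH vsH vt])
       (simp_all only: bilinear_map_props[OF b1] bilinear_map_props[OF b2])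
  \<comment> \<open>The integrand of \<open>comult_tensor_id\<close> is itself a lift; its linearity
    in the comodule variable is read off from a presentation of \<open>\<Delta> x\<close>.\<close>
  have l: "Vector_Spaces.linear scaleV tscale
      (\<lambda>v. tensor_lift scaleH scaleH (\<lambda>a b. tens scaleH tscale a (tens scaleH scaleV b v)) (\<Delta> x))" for x
  proof -
    obtain ys where ys: "\<Delta> x = (\<Sum>(v, w)\<leftarrow>ys. tens scaleH scaleH v w)"
      using tensor_space_sum_list[OF vsH vsH H.comult_in_tensor] by metis
    interpret t: vector_space "tscale :: 'k \<Rightarrow> ('k, 'h, ('k, 'h, 'v) tensor) tensor \<Rightarrow> _"
      by (rule vt)
    show ?thesis
      unfolding ys tensor_lift_sum_list[OF b]
    proof (intro linearI vsV vt)
      fix x y c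
      show "(\<Sum>(a, b)\<leftarrow>ys. tens scaleH tscale a (tens scaleH scaleV b (x + y))) =
          (\<Sum>(a, b)\<leftarrow>ys. tens scaleH tscale a (tens scaleH scaleV b x)) +
          (\<Sum>(a, b)\<leftarrow>ys. tens scaleH tscale a (tens scaleH scaleV b y))"
        by (simp only: bilinear_map_props[OF b1] bilinear_map_props[OF b2] case_prod_unfold
            sum_list_addf)
      show "(\<Sum>(a, b)\<leftarrow>ys. tens scaleH tscale a (tens scaleH scaleV b (scaleV c x))) =
          tscale c (\<Sum>(a, b)\<leftarrow>ys. tens scaleH tscale a (tens scaleH scaleV b x))"
        by (induction ys) (auto simp only: bilinear_map_props[OF b1] bilinear_map_props[OF b2]
            t.scale_right_distrib t.scale_zero_right list.map sum_list.Nil sum_list.Cons prod.case)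
    qed
  qed
  have bc: "bilinear_map scaleH scaleV tscale (\<lambda>x v. tensor_lift scaleH scaleH
      (\<lambda>a b. tens scaleH tscale a (tens scaleH scaleV b v)) (\<Delta> x))"
    unfolding bilinear_map_def
    by (intro conjI allI l linearI vsH vt)
       (simp_all only: linear_props[OF H.comult_linear] tensor_lift_add[OF b]
         tensor_lift_scale[OF b] H.comult_in_tensor)
  have bi: "bilinear_map scaleH scaleV tscale (\<lambda>x v. tens scaleH tscale x (\<rho> v))"
    by (rule bilinear_mapI[OF vsH vsV vt])
       (simp_all only: linear_props[OF coact_linear] bilinear_map_props[OF b2])
  let ?g = "lslice scaleH tscale f"
  note bg = bilinear_map_lslice[OF f vt]
  have "?g (comult_tensor_id scaleH scaleV \<Delta> (\<rho> v)) =
      (\<Sum>(h, w)\<leftarrow>xs. ?g (tensor_lift scaleH scaleH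
        (\<lambda>a b. tens scaleH tscale a (tens scaleH scaleV b w)) (\<Delta> h)))"
    unfolding comult_tensor_id_def v tensor_lift_sum_list[OF bc] lslice_def
    by (subst tensor_lift_sum[OF bg])
       (auto simp: case_prod_unfold H.tensor_lift_comult_lslice(2)[OF f vsV])
  also have "\<dots> = (\<Sum>(h, w)\<leftarrow>xs. tens scaleH scaleV (lslice scaleH scaleH f (\<Delta> h)) w)"
    by (simp only: H.tensor_lift_comult_lslice(1)[OF f vsV])
  finally have 1: "?g (comult_tensor_id scaleH scaleV \<Delta> (\<rho> v)) = \<dots>" .
  have "?g (id_tensor_coact scaleH scaleV \<rho> (\<rho> v)) = (\<Sum>(h, w)\<leftarrow>xs. ?g (tens scaleH tscale h (\<rho> w)))"
    unfolding id_tensor_coact_def v tensor_lift_sum_list[OF bi] lslice_def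
    by (subst tensor_lift_sum[OF bg]) (auto simp: case_prod_unfold tens_in_tensor_space)
  also have "\<dots> = (\<Sum>(h, w)\<leftarrow>xs. tscale (f h) (\<rho> w))"
    by (simp only: lslice_tens[OF f vt])
  also have "\<dots> = \<rho> (\<Sum>(h, w)\<leftarrow>xs. scaleV (f h) w)"
    unfolding linear_sum_list[OF coact_linear]
    by (simp add: case_prod_unfold linear_props(2)[OF coact_linear])
  also have "\<dots> = \<rho> (act f v)" by (simp add: act_def v lslice_sum_list[OF f vsV])
  finally show ?thesis using 1 coact_coassoc[of v] by simp
qed

text \<open>Contract the right factor in \<open>coact_act\<close> with \<open>\<phi>\<close>. The
  result says that \<open>coeff \<phi>\<close> is a comodule map from \<open>V\<close> to
  \<open>H\<close> with coaction \<open>\<Delta>\<close>.\<close>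

lemma coeff_act:
  assumes f: "linear_form scaleH f" and \<phi>: "linear_form scaleV \<phi>"
  shows "coeff \<phi> (act f v) = lslice scaleH scaleH f (\<Delta> (coeff \<phi> v))"
proof -
  obtain xs where v: "\<rho> v = (\<Sum>(h, w)\<leftarrow>xs. tens scaleH scaleV h w)" by (rule coact_sum_list)
  note l = H.linear_comult_lslice[OF f]
  have "\<rho> (act f v) = (\<Sum>(h, w)\<leftarrow>map (\<lambda>(h, w). (lslice scaleH scaleH f (\<Delta> h), w)) xs.
      tens scaleH scaleV h w)"
    using coact_act[OF f v] by (simp add: case_prod_unfold o_def)
  then have "coeff \<phi> (act f v) = (\<Sum>(h, w)\<leftarrow>xs. scaleH (\<phi> w) (lslice scaleH scaleH f (\<Delta> h)))"
    unfolding coeff_def by (simp only: rslice_sum_list[OF \<phi> vsH])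
      (simp add: case_prod_unfold o_def)
  also have "\<dots> = lslice scaleH scaleH f (\<Delta> (\<Sum>(h, w)\<leftarrow>xs. scaleH (\<phi> w) h))"
    unfolding linear_sum_list[OF l] by (simp add: case_prod_unfold linear_props(2)[OF l])
  finally show ?thesis by (simp only: coeff_def v rslice_sum_list[OF \<phi> vsH])
qed

lemma linear_form_act:
  assumes "linear_form scaleH f" "linear_form scaleV \<phi>"
  shows "linear_form scaleV (\<lambda>v. \<phi> (act f v))"
  by (rule linearI) (simp_all add: vsV vector_space_mult linear_props[OF assms(2)]
      linear_props[OF linear_act[OF assms(1)]])

text \<open>Right slices change the form and keep the vector, whereas left slices do the opposite in
  \<open>coeff_act\<close>. Paired with \<open>f'\<close>, both sides become
  \<open>\<phi> (act f (act f' v))\<close>.\<close>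

lemma rslice_comult_coeff:
  assumes f: "linear_form scaleH f" and \<phi>: "linear_form scaleV \<phi>"
  shows "rslice scaleH scaleH f (\<Delta> (coeff \<phi> v)) = coeff (\<lambda>v. \<phi> (act f v)) v"
proof (rule linear_form_eqI[OF vsH])
  fix f' assume f': "linear_form scaleH f'"
  have "f' (rslice scaleH scaleH f (\<Delta> (coeff \<phi> v))) = f (coeff \<phi> (act f' v))"
    by (simp add: coeff_act[OF f' \<phi>] lslice_rslice[OF f' f] H.comult_in_tensor)
  then show "f' (rslice scaleH scaleH f (\<Delta> (coeff \<phi> v))) = f' (coeff (\<lambda>v. \<phi> (act f v)) v)"
    by (simp add: form_coeff f f' \<phi> linear_form_act)
qed

text \<open>The module law: the form on the right is the convolution product of \<open>f\<close> and
  \<open>f'\<close>.\<close>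

lemma act_act:
  assumes "linear_form scaleH f" "linear_form scaleH f'"
  shows "act f' (act f v) = act (\<lambda>h. f' (lslice scaleH scaleH f (\<Delta> h))) v"
proof (rule linear_form_eqI[OF vsV])
  fix \<phi> assume "linear_form scaleV \<phi>"
  then show "\<phi> (act f' (act f v)) = \<phi> (act (\<lambda>h. f' (lslice scaleH scaleH f (\<Delta> h))) v)"
    using assms coeff_act[of f \<phi> v]
    by (simp add: form_coeff[symmetric] H.linear_form_comult_lslice)
qed

lemma linear_form_add:
  assumes "linear_form scaleH f" "linear_form scaleH f'"
  shows "linear_form scaleH (\<lambda>h. f h + f' h)"
  by (rule linearI) (simp_all add: vsH vector_space_mult linear_props[OF assms(1)]
      linear_props[OF assms(2)] algebra_simps)

lemma linear_form_scale:
  assumes "linear_form scaleH f"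
  shows "linear_form scaleH (\<lambda>h. c * f h)"
  by (rule linearI) (simp_all add: vsH vector_space_mult linear_props[OF assms(1)] algebra_simps)

text \<open>The orbit is the subcomodule generated by \<open>v\<close>: forms can be added and
  scaled, and \<open>act_act\<close> absorbs a further action into a convolution.\<close>

lemma orbit_stable: "stable {act f v | f. linear_form scaleH f}"
proof -
  have add: "act f v + act f' v = act (\<lambda>h. f h + f' h) v"
    if "linear_form scaleH f" "linear_form scaleH f'" for f f'
  proof (rule linear_form_eqI[OF vsV])
    fix \<phi> assume \<phi>: "linear_form scaleV \<phi>"
    show "\<phi> (act f v + act f' v) = \<phi> (act (\<lambda>h. f h + f' h) v)"
      using that \<phi> linear_props[OF \<phi>] by (simp add: form_coeff[symmetric] linear_form_add)
  qed
  have scale: "scaleV c (act f v) = act (\<lambda>h. c * f h) v" if "linear_form scaleH f" for f c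
  proof (rule linear_form_eqI[OF vsV])
    fix \<phi> assume \<phi>: "linear_form scaleV \<phi>"
    show "\<phi> (scaleV c (act f v)) = \<phi> (act (\<lambda>h. c * f h) v)"
      using that \<phi> linear_props[OF \<phi>] by (simp add: form_coeff[symmetric] linear_form_scale)
  qed
  have zero: "0 = act (\<lambda>h. 0 * \<epsilon> h) v" using scale[OF H.counit_linear, of 0] by simp
  show ?thesis
    unfolding stable_def
  proof (intro conjI V.subspaceI allI impI subsetI)
    show "0 \<in> {act f v | f. linear_form scaleH f}"
      using zero linear_form_scale[OF H.counit_linear, of 0] by blast
  next
    fix x y assume "x \<in> {act f v | f. linear_form scaleH f}" "y \<in> {act f v | f. linear_form scaleH f}"
    then obtain f f' where "linear_form scaleH f" "linear_form scaleH f'" "x = act f v" "y = act f' v"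
      by blast
    then show "x + y \<in> {act f v | f. linear_form scaleH f}"
      using add linear_form_add by blast
  next
    fix c x assume "x \<in> {act f v | f. linear_form scaleH f}"
    then obtain f where "linear_form scaleH f" "x = act f v" by blast
    then show "scaleV c x \<in> {act f v | f. linear_form scaleH f}"
      using scale linear_form_scale by blast
  next
    fix f x assume f: "linear_form scaleH f" and "x \<in> act f ` {act f v | f. linear_form scaleH f}"
    then obtain f' where f': "linear_form scaleH f'" "x = act f (act f' v)" by blast
    then show "x \<in> {act f v | f. linear_form scaleH f}"
      using act_act[OF f'(1) f] H.linear_form_comult_lslice[OF f'(1) f] by blast
  qed
qed

text \<open>Local finiteness: all slices of \<open>\<rho> v\<close> lie in the span of the finitely
  many right factors of one presentation.\<close>

lemma orbit_finite_dim:
  obtains F where "finite F" "{act f v | f. linear_form scaleH f} \<subseteq> V.span F"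
proof -
  obtain xs where v: "\<rho> v = (\<Sum>(h, w)\<leftarrow>xs. tens scaleH scaleV h w)" by (rule coact_sum_list)
  have "\<rho> v \<in> tensor_space scaleH scaleV UNIV (V.span (snd ` set xs))"
    unfolding v by (rule tensor_space_sum_listI)
      (auto intro!: tens_in_tensor_space V.span_base rev_image_eqI)
  then have "act f v \<in> V.span (snd ` set xs)" if "linear_form scaleH f" for f
    unfolding act_def using lslice_in_subspace[OF vsH vsV V.subspace_span that] by blast
  then show thesis using that[of "snd ` set xs"] by auto
qed

text \<open>The left factors in presentations of \<open>\<rho> v\<close>, for \<open>v\<close> in
  \<open>F\<close>, serve all forms \<open>\<phi>\<close> at once.\<close>

lemma coeff_finite_dim:
  assumes "finite F"
  obtains G where "finite G"
    "\<And>\<phi> w. linear_form scaleV \<phi> \<Longrightarrow> w \<in> V.span F \<Longrightarrow> coeff \<phi> w \<in> H.span G"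
proof -
  have "\<exists>G. finite G \<and> (\<forall>\<phi>. linear_form scaleV \<phi> \<longrightarrow> coeff \<phi> v \<in> H.span G)" for v
  proof -
    obtain xs where v: "\<rho> v = (\<Sum>(h, w)\<leftarrow>xs. tens scaleH scaleV h w)" by (rule coact_sum_list)
    have "(\<Sum>(h, w)\<leftarrow>ys. scaleH (\<phi> w) h) \<in> H.span (fst ` set xs)" if "set ys \<subseteq> set xs" for ys \<phi>
      using that
    proof (induction ys)
      case (Cons p ys)
      then have "fst p \<in> H.span (fst ` set xs)" by (intro H.span_base) simp
      then show ?case using Cons by (auto simp: case_prod_unfold H.span_add H.span_scale)
    qed (simp add: H.span_zero)
    then have "coeff \<phi> v \<in> H.span (fst ` set xs)" if "linear_form scaleV \<phi>" for \<phi>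
      by (simp add: coeff_def v rslice_sum_list[OF that vsH])
    then show ?thesis by (intro exI[of _ "fst ` set xs"]) auto
  qed
  then obtain G where G: "\<And>v. finite (G v)"
    "\<And>v \<phi>. linear_form scaleV \<phi> \<Longrightarrow> coeff \<phi> v \<in> H.span (G v)" by metis
  have "coeff \<phi> w \<in> H.span (\<Union>v\<in>F. G v)" if \<phi>: "linear_form scaleV \<phi>" and w: "w \<in> V.span F" for \<phi> w
    using w
  proof (induction rule: V.span_induct_alt)
    case base
    show ?case by (simp add: linear_props(3)[OF linear_coeff[OF \<phi>]] H.span_zero)
  next
    case (step c x y)
    have "coeff \<phi> x \<in> H.span (\<Union>v\<in>F. G v)" using step(1) G(2)[OF \<phi>] H.span_mono by blast
    then show ?case using step
      by (simp add: linear_props[OF linear_coeff[OF \<phi>]] H.span_add H.span_scale)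
  qed
  then show thesis using that[of "\<Union>v\<in>F. G v"] G(1) assms by blast
qed

text \<open>Since the forms vanish on \<open>M\<close>, this is the coefficient space of the image
  of \<open>W\<close> in \<open>V / M\<close>. Left slices of \<open>\<Delta>\<close> replace
  \<open>w\<close> by \<open>act f w\<close>, still in \<open>W\<close>; right slices replace
  \<open>\<phi>\<close> by its composite with \<open>act f\<close>, which still kills
  \<open>M\<close>.\<close>

lemma coeff_span_subcoalgebra:
  assumes "stable W" "stable M"
    and D: "D = H.span {coeff \<phi> w | \<phi> w. linear_form scaleV \<phi> \<and> (\<forall>m\<in>M. \<phi> m = 0) \<and> w \<in> W}"
      (is "D = H.span ?C")
  shows "H.subcoalgebra D"
proof -
  have l: "lslice scaleH scaleH f (\<Delta> d) \<in> D" if f: "linear_form scaleH f" and d: "d \<in> D" for f d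
    using d unfolding D
  proof (induction rule: H.span_induct_alt)
    case base
    show ?case by (simp add: linear_props(3)[OF H.linear_comult_lslice[OF f]] H.span_zero)
  next
    case (step c x y)
    then obtain \<phi> w where x: "x = coeff \<phi> w" "linear_form scaleV \<phi>" "\<forall>m\<in>M. \<phi> m = 0" "w \<in> W" by blast
    then have "act f w \<in> W" using assms(1) f by (auto simp: stable_def)
    then have "lslice scaleH scaleH f (\<Delta> x) \<in> H.span ?C"
      using x coeff_act[OF f x(2), of w, symmetric] by (intro H.span_base) auto
    then show ?case using step(2)
      by (simp add: linear_props[OF H.linear_comult_lslice[OF f]] H.span_add H.span_scale)
  qed
  have r: "rslice scaleH scaleH f (\<Delta> d) \<in> D" if f: "linear_form scaleH f" and d: "d \<in> D" for f d
    using d unfolding D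
  proof (induction rule: H.span_induct_alt)
    case base
    show ?case by (simp add: linear_props(3)[OF H.linear_comult_rslice[OF f]] H.span_zero)
  next
    case (step c x y)
    then obtain \<phi> w where x: "x = coeff \<phi> w" "linear_form scaleV \<phi>" "\<forall>m\<in>M. \<phi> m = 0" "w \<in> W" by blast
    have "\<forall>m\<in>M. \<phi> (act f m) = 0" using assms(2) f x(3) by (auto simp: stable_def image_subset_iff)
    then have "rslice scaleH scaleH f (\<Delta> x) \<in> H.span ?C"
      using x(4) linear_form_act[OF f x(2)] unfolding x(1) rslice_comult_coeff[OF f x(2), of w]
      by (intro H.span_base) blast
    then show ?case using step(2)
      by (simp add: linear_props[OF H.linear_comult_rslice[OF f]] H.span_add H.span_scale)
  qed
  show ?thesis
    unfolding H.subcoalgebra_def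
    using tensor_space_slices[OF vsH vsH H.comult_in_tensor _ l r] H.subspace_span[of ?C]
    by (auto simp: D)
qed

text \<open>
  If every stable proper subspace of \<open>W\<close> lies in \<open>M\<close>, then \<open>W / (W \<inter> M)\<close> is a simple comodule, and
  its coefficient space is a sum of copies \<open>coeff \<phi> ` W\<close> of it; a grouplike \<open>g\<close> in this sum projects
  to a semi-invariant in one of the copies.
\<close>

lemma grouplike_coeff_semi_invariant:
  assumes W: "stable W" "\<not> W \<subseteq> M" "\<And>U. stable U \<Longrightarrow> \<not> U \<subseteq> M \<Longrightarrow> U \<subseteq> W \<Longrightarrow> U = W"
    and M: "stable M"
    and g: "\<Delta> g = tens scaleH scaleH g g" "g \<noteq> 0"
    and \<Phi>: "finite \<Phi>" "\<And>\<phi>. \<phi> \<in> \<Phi> \<Longrightarrow> linear_form scaleV \<phi>" "\<And>\<phi> m. \<phi> \<in> \<Phi> \<Longrightarrow> m \<in> M \<Longrightarrow> \<phi> m = 0"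
    and "g \<in> H.span (\<Union>\<phi>\<in>\<Phi>. coeff \<phi> ` W)"
  shows "\<exists>u\<in>W. u \<notin> M \<and> (\<forall>f. linear_form scaleH f \<longrightarrow> act f u - scaleV (f g) u \<in> M)"
  using \<Phi> assms(10)
proof (induction \<Phi> rule: finite_induct)
  case empty
  then show ?case using g(2) by simp
next
  case (insert \<phi> \<Phi>)
  let ?R = "H.span (\<Union>\<phi>\<in>\<Phi>. coeff \<phi> ` W)"
  have \<phi>: "linear_form scaleV \<phi>" using insert.prems by simp
  have subW: "V.subspace W" and subM: "V.subspace M" using W(1) M by (simp_all add: stable_def)
  \<comment> \<open>\<open>?R\<close> is a subcomodule of \<open>H\<close>, being spanned by images
    of \<open>W\<close> under the comodule maps \<open>coeff \<psi>\<close>.\<close>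
  have R: "lslice scaleH scaleH f (\<Delta> d) \<in> ?R" if f: "linear_form scaleH f" and d: "d \<in> ?R" for f d
    using d
  proof (induction rule: H.span_induct_alt)
    case base
    show ?case by (simp add: linear_props(3)[OF H.linear_comult_lslice[OF f]] H.span_zero)
  next
    case (step c x y)
    then obtain \<psi> w where x: "x = coeff \<psi> w" "\<psi> \<in> \<Phi>" "w \<in> W" by blast
    then have "act f w \<in> W" using W(1) f by (auto simp: stable_def)
    then have "lslice scaleH scaleH f (\<Delta> x) \<in> ?R"
      using x coeff_act[OF f, of \<psi> w, symmetric] insert.prems(1)[of \<psi>] by (intro H.span_base) auto
    then show ?case using step(2)
      by (simp add: linear_props[OF H.linear_comult_lslice[OF f]] H.span_add H.span_scale)
  qed
  have "module_hom scaleV scaleH (coeff \<phi>)"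
    using linear_coeff[OF \<phi>] by (simp add: linear_iff_module_hom)
  then have "H.subspace (coeff \<phi> ` W)" using subW by (rule module_hom.subspace_image)
  then have sp: "H.span (coeff \<phi> ` W) = coeff \<phi> ` W" by (simp only: H.span_eq_iff)
  have "g \<in> H.span (coeff \<phi> ` W \<union> (\<Union>\<phi>\<in>\<Phi>. coeff \<phi> ` W))" using insert.prems(3) by simp
  then obtain u r where u: "u \<in> W" "r \<in> ?R" "g = coeff \<phi> u + r"
    unfolding H.span_Un sp by blast
  have IH: ?case if "g \<in> ?R" using insert.IH insert.prems that by blast
  \<comment> \<open>By the minimality of \<open>W\<close>, the stable subspace \<open>U\<close> is
    \<open>W\<close> or lies in \<open>M\<close>: either the coefficients of \<open>\<phi>\<close>
    add nothing to \<open>?R\<close>, or only vectors of \<open>M\<close> have their coefficient in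
    \<open>?R\<close>.\<close>
  define U where "U = {w \<in> W. coeff \<phi> w \<in> ?R}"
  have "stable U"
    unfolding stable_def
  proof (intro conjI allI impI)
    show "V.subspace U"
      unfolding U_def using subW linear_props[OF linear_coeff[OF \<phi>]]
      by (intro V.subspaceI) (auto simp: V.subspace_0 V.subspace_add V.subspace_scale H.span_zero
          H.span_add H.span_scale)
    show "act f ` U \<subseteq> U" if "linear_form scaleH f" for f
      unfolding U_def using R[OF that] coeff_act[OF that \<phi>] W(1) that
      by (auto simp: stable_def image_subset_iff)
  qed
  show ?case
  proof (cases "U \<subseteq> M")
    case False
    then have "U = W" using W(3)[OF \<open>stable U\<close>] by (auto simp: U_def)
    then have "coeff \<phi> u \<in> ?R" using u(1) by (auto simp: U_def)
    then show ?thesis using u by (intro IH) (simp add: H.span_add)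
  next
    case UM: True
    show ?thesis
    proof (cases "u \<in> M")
      case True
      \<comment> \<open>The orbit of \<open>u\<close> stays in \<open>M\<close>, where
        \<open>\<phi>\<close> vanishes. Then \<open>g = r\<close> lies in \<open>?R\<close> and the
        induction hypothesis applies.\<close>
      have "coeff \<phi> u = 0"
      proof (rule linear_form_eqI[OF vsH])
        fix f assume f: "linear_form scaleH f"
        then have "act f u \<in> M" using M True by (auto simp: stable_def)
        then show "f (coeff \<phi> u) = f 0"
          using insert.prems(2) by (simp add: form_coeff[OF f \<phi>] linear_props(3)[OF f])
      qed
      then show ?thesis using u by (intro IH) simp
    next
      case False
      \<comment> \<open>Modulo \<open>?R\<close>, \<open>coeff \<phi> u\<close> agrees with
        \<open>g\<close>, and slicing \<open>\<Delta> g\<close> by \<open>f\<close> multiplies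
        \<open>g\<close> by \<open>f g\<close>. So the coefficient of the difference lies in
        \<open>?R\<close>.\<close>
      have "act f u - scaleV (f g) u \<in> U" if f: "linear_form scaleH f" for f
      proof -
        let ?L = "\<lambda>h. lslice scaleH scaleH f (\<Delta> h)"
        note l = H.linear_comult_lslice[OF f]
        have c: "coeff \<phi> u = g - r" using u(3) by simp
        have "coeff \<phi> (act f u - scaleV (f g) u) = ?L (g - r) - scaleH (f g) (g - r)"
          by (simp add: linear_props[OF linear_coeff[OF \<phi>]] coeff_act[OF f \<phi>] c)
        also have "\<dots> = scaleH (f g) r - ?L r"
          using g(1) by (simp add: linear_props(4)[OF l] lslice_tens[OF f vsH] H.scale_right_diff_distrib)
        also have "\<dots> \<in> ?R" using R[OF f u(2)] u(2) by (simp add: H.span_diff H.span_scale)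
        finally show ?thesis
          using u(1) W(1) f subW unfolding U_def
          by (auto simp: stable_def image_subset_iff V.subspace_diff V.subspace_scale)
      qed
      then show ?thesis using UM False u(1) by blast
    qed
  qed
qed

text \<open>Local finiteness gives a minimal stable \<open>W\<close> inside the orbit of
  \<open>b\<close> but not inside \<open>M\<close>. The coefficient space of \<open>W\<close> modulo
  \<open>M\<close> is a nonzero finite-dimensional subcoalgebra, so it contains a grouplike, which
  \<open>grouplike_coeff_semi_invariant\<close> turns into a semi-invariant in
  \<open>W\<close>.\<close>

theorem pointed_obtains_semi_invariant:
  assumes pointed: "H.pointed" and N: "subcomodule N" and M: "subcomodule M"
    and b: "b \<in> N" "b \<notin> M"
  obtains m g where "m \<in> N" "m \<notin> M" "g \<noteq> 0" "\<Delta> g = tens scaleH scaleH g g"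
    "\<And>f. linear_form scaleH f \<Longrightarrow> act f m - scaleV (f g) m \<in> M"
proof -
  let ?O = "{act f b | f. linear_form scaleH f}"
  define P where "P W \<longleftrightarrow> stable W \<and> \<not> W \<subseteq> M" for W
  have sN: "stable N" and sM: "stable M" using N M by (simp_all add: subcomodule_iff_stable)
  have "b \<in> ?O" by (rule CollectI, rule exI[of _ \<epsilon>]) (simp add: act_counit H.counit_linear)
  then have O: "P ?O" unfolding P_def using orbit_stable b(2) by (meson subsetD)
  have ON: "?O \<subseteq> N" using sN b(1) by (auto simp: stable_def)
  obtain F where F: "finite F" "?O \<subseteq> V.span F" by (rule orbit_finite_dim)
  have PS: "\<forall>W. P W \<longrightarrow> V.subspace W" by (simp add: P_def stable_def)
  obtain W where "W \<subseteq> ?O \<and> P W \<and> (\<forall>W'\<subseteq>W. P W' \<longrightarrow> W' = W)"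
    using V.minimal_finite_dim_subspace[of F ?O P, OF F O PS] ..
  then have W: "W \<subseteq> ?O" "P W" "\<forall>W'\<subseteq>W. P W' \<longrightarrow> W' = W" by simp_all
  let ?C = "{coeff \<phi> w | \<phi> w. linear_form scaleV \<phi> \<and> (\<forall>m\<in>M. \<phi> m = 0) \<and> w \<in> W}"
  have D: "H.subcoalgebra (H.span ?C)"
    by (rule coeff_span_subcoalgebra[OF _ sM refl]) (use W(2) in \<open>simp add: P_def\<close>)
  obtain G where G: "finite G" "\<And>\<phi> w. linear_form scaleV \<phi> \<Longrightarrow> w \<in> V.span F \<Longrightarrow> coeff \<phi> w \<in> H.span G"
    using coeff_finite_dim[OF F(1)] by blast
  have "?C \<subseteq> H.span G"
  proof
    fix c assume "c \<in> ?C"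
    then obtain \<phi> w where "c = coeff \<phi> w" "linear_form scaleV \<phi>" "w \<in> W" by blast
    moreover from this have "w \<in> V.span F" using F(2) W(1) by (meson subsetD)
    ultimately show "c \<in> H.span G" using G(2) by simp
  qed
  then have DG: "H.span ?C \<subseteq> H.span G" by (simp add: H.span_minimal)
  obtain w where w: "w \<in> W" "w \<notin> M" using W(2) by (auto simp: P_def)
  obtain \<phi> where \<phi>: "linear_form scaleV \<phi>" "\<And>m. m \<in> M \<Longrightarrow> \<phi> m = 0" "\<phi> w = 1"
    using linear_form_separates_subspace[OF vsV _ w(2)] sM by (auto simp: stable_def)
  \<comment> \<open>The counit sends the coefficient to \<open>\<phi> w\<close>, so the coefficient
    space is not zero.\<close>
  have "\<epsilon> (coeff \<phi> w) = 1" using form_coeff[OF H.counit_linear \<phi>(1)] by (simp add: act_counit \<phi>(3))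
  then have "coeff \<phi> w \<noteq> 0" using linear_props(3)[OF H.counit_linear] by auto
  moreover have "coeff \<phi> w \<in> H.span ?C" using \<phi> w by (intro H.span_base) blast
  ultimately have D0: "H.span ?C \<noteq> {0}" by blast
  obtain g where g: "g \<in> H.span ?C" "g \<noteq> 0" "\<Delta> g = tens scaleH scaleH g g"
    using H.pointed_obtains_grouplike[OF pointed D D0 G(1) DG] by blast
  let ?\<Phi> = "{\<phi>. linear_form scaleV \<phi> \<and> (\<forall>m\<in>M. \<phi> m = 0)}"
  obtain T where T: "finite T" "T \<subseteq> ?C" "g \<in> H.span T"
  proof -
    obtain T c where T: "finite T" "T \<subseteq> ?C" "g = (\<Sum>a\<in>T. scaleH (c a) a)"
      using g(1) unfolding H.span_explicit[of ?C] by blast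
    have "g \<in> H.span T" unfolding T(3) by (intro H.span_sum H.span_scale H.span_base)
    then show thesis by (rule that[OF T(1,2)])
  qed
  \<comment> \<open>One form is chosen for each element of \<open>T\<close>, because the induction
    producing the semi-invariant runs over a finite set of forms.\<close>
  have "\<forall>t\<in>T. \<exists>\<phi>. \<phi> \<in> ?\<Phi> \<and> t \<in> coeff \<phi> ` W"
  proof
    fix t assume "t \<in> T"
    then have "t \<in> ?C" using T(2) by (rule rev_subsetD)
    then show "\<exists>\<phi>. \<phi> \<in> ?\<Phi> \<and> t \<in> coeff \<phi> ` W" by blast
  qed
  from bchoice[OF this] obtain p where p: "\<forall>t\<in>T. p t \<in> ?\<Phi> \<and> t \<in> coeff (p t) ` W" ..
  have span: "g \<in> H.span (\<Union>\<phi>\<in>p ` T. coeff \<phi> ` W)"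
    by (rule subsetD[OF H.span_mono T(3)]) (use p in auto)
  have "\<exists>u\<in>W. u \<notin> M \<and> (\<forall>f. linear_form scaleH f \<longrightarrow> act f u - scaleV (f g) u \<in> M)"
    by (rule grouplike_coeff_semi_invariant[OF _ _ _ sM g(3,2) _ _ _ span])
       (use W T(1) p in \<open>auto simp: P_def\<close>)
  then obtain u where "u \<in> W" "u \<notin> M" "\<forall>f. linear_form scaleH f \<longrightarrow> act f u - scaleV (f g) u \<in> M"
    by blast
  then show thesis using that[of u g] g(2,3) W(1) ON by (meson subsetD)
qed

end

section \<open>Right modules over a subalgebra\<close>

text \<open>The two halves of \<open>right_module_basis\<close> are separated: Zorn's lemma will run
  over independent sets, and spanning will come from maximality.\<close>

definition right_span :: "'b::ring_1 set \<Rightarrow> 'b set \<Rightarrow> 'b set" where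
  "right_span A X = 
     {b. \<exists>F c. finite F \<and> F \<subseteq> X \<and> (\<forall>x\<in>F. c x \<in> A) \<and> b = (\<Sum>x\<in>F. x * c x)}"

definition right_independent :: "'b::ring_1 set \<Rightarrow> 'b set \<Rightarrow> bool" where
  "right_independent A X \<longleftrightarrow>
     (\<forall>F c. finite F \<and> F \<subseteq> X \<and> (\<forall>x\<in>F. c x \<in> A) \<and> (\<Sum>x\<in>F. x * c x) = 0 \<longrightarrow> (\<forall>x\<in>F. c x = 0))"

lemma right_module_basis_iff:
  "right_module_basis A X \<longleftrightarrow> right_span A X = UNIV \<and> right_independent A X"
  unfolding right_module_basis_def right_span_def right_independent_def
  by (simp only: set_eq_iff mem_Collect_eq UNIV_I simp_thms)

lemma right_spanI:
  "finite F \<Longrightarrow> F \<subseteq> X \<Longrightarrow> \<forall>x\<in>F. c x \<in> A \<Longrightarrow> (\<Sum>x\<in>F. x * c x) \<in> right_span A X"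
  unfolding right_span_def by blast

lemma right_spanE:
  assumes "b \<in> right_span A X"
  obtains F c where "finite F" "F \<subseteq> X" "\<forall>x\<in>F. c x \<in> A" "b = (\<Sum>x\<in>F. x * c x)"
  using assms unfolding right_span_def by blast

lemma right_span_base: "x \<in> X \<Longrightarrow> a \<in> A \<Longrightarrow> x * a \<in> right_span A X"
  using right_spanI[of "{x}" X "\<lambda>_. a" A] by simp

lemma right_span_mono: "X \<subseteq> Y \<Longrightarrow> right_span A X \<subseteq> right_span A Y"
  unfolding right_span_def by blast

text \<open>A combination involves finitely many elements, and these lie in one member of a nonempty
  chain.\<close>

lemma right_span_Union_chain:
  assumes "C \<noteq> {}" "subset.chain \<A> C"
  shows "right_span A (\<Union>C) = (\<Union>X\<in>C. right_span A X)"
proof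
  show "right_span A (\<Union>C) \<subseteq> (\<Union>X\<in>C. right_span A X)"
  proof
    fix b assume "b \<in> right_span A (\<Union>C)"
    then obtain F c where F: "finite F" "F \<subseteq> \<Union>C" "\<forall>x\<in>F. c x \<in> A" "b = (\<Sum>x\<in>F. x * c x)"
      by (rule right_spanE)
    obtain X where "X \<in> C" "F \<subseteq> X" by (rule finite_subset_Union_chain[OF F(1,2) assms])
    then show "b \<in> (\<Union>X\<in>C. right_span A X)" using right_spanI[OF F(1) _ F(3)] F(4) by blast
  qed
  show "(\<Union>X\<in>C. right_span A X) \<subseteq> right_span A (\<Union>C)"
    by (intro UN_least right_span_mono Union_upper)
qed

lemma right_independent_Union_chain:
  assumes "C \<noteq> {}" "subset.chain \<A> C" "\<And>X. X \<in> C \<Longrightarrow> right_independent A X"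
  shows "right_independent A (\<Union>C)"
  unfolding right_independent_def
proof (intro allI impI)
  fix F c
  assume F: "finite F \<and> F \<subseteq> \<Union>C \<and> (\<forall>x\<in>F. c x \<in> A) \<and> (\<Sum>x\<in>F. x * c x) = 0"
  then have "finite F" "F \<subseteq> \<Union>C" by simp_all
  then obtain X where "X \<in> C" "F \<subseteq> X" by (rule finite_subset_Union_chain[OF _ _ assms(1,2)])
  then show "\<forall>x\<in>F. c x = 0" using assms(3) F unfolding right_independent_def by blast
qed

text \<open>In finite dimension an injective endomorphism is onto: the image of a basis is an
  independent subset of \<open>A\<close> of full cardinality.\<close>

lemma (in vector_space) injective_image_eq:
  assumes "finite F" "span F = A" "Vector_Spaces.linear scale scale T" "T ` A \<subseteq> A" "inj_on T A"
  shows "T ` A = A"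
proof -
  have hom: "module_hom scale scale T" using assms(3) by (simp add: linear_iff_module_hom)
  have sub: "subspace A" using assms(2) by auto
  obtain X where X: "X \<subseteq> A" "independent X" "A \<subseteq> span X" using maximal_independent_subset by metis
  have XA: "span X = A" using X sub by (metis span_minimal subset_antisym)
  have ind: "independent (T ` X)"
    by (rule module_hom.independent_injective_image[OF hom X(2)]) (simp add: XA assms(5))
  obtain Y where Y: "T ` X \<subseteq> Y" "Y \<subseteq> A" "independent Y" "A \<subseteq> span Y"
    using maximal_independent_subset_extend[OF _ ind] X(1) assms(4) by (metis image_mono order_trans)
  have "card Y = dim A" "card X = dim A" using X Y by (simp_all add: basis_card_eq_dim)
  moreover have "card (T ` X) = card X" using assms(5) X(1) by (meson card_image inj_on_subset)
  moreover have "finite Y" using independent_span_bound[OF assms(1) Y(3)] Y(2) assms(2) by simp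
  ultimately have "T ` X = Y" using Y(1) by (simp add: card_seteq)
  then have "A \<subseteq> T ` A" using Y(4) module_hom.span_image[OF hom, of X] XA by simp
  then show ?thesis using assms(4) by blast
qed

section \<open>Right spans and independent sets over a subalgebra\<close>

context unital_algebra
begin

context
  fixes A :: "'a set"
  assumes A: "subalgebra A"
begin

lemma subspace_right_span: "subspace (right_span A X)"
proof (rule subspaceI)
  have sub: "subspace A" using A by (simp add: subalgebra_def)
  show "0 \<in> right_span A X" using right_spanI[of "{}" X] by simp
  show "x + y \<in> right_span A X" if "x \<in> right_span A X" "y \<in> right_span A X" for x y
  proof -
    from that(1) obtain F c where F: "finite F" "F \<subseteq> X" "\<forall>x\<in>F. c x \<in> A" "x = (\<Sum>x\<in>F. x * c x)"
      by (rule right_spanE)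
    from that(2) obtain G d where G: "finite G" "G \<subseteq> X" "\<forall>x\<in>G. d x \<in> A" "y = (\<Sum>x\<in>G. x * d x)"
      by (rule right_spanE)
    \<comment> \<open>Padding both coefficient families with \<open>0\<close> brings the two
      combinations to the common index set \<open>F \<union> G\<close>.\<close>
    let ?c = "\<lambda>x. if x \<in> F then c x else 0" and ?d = "\<lambda>x. if x \<in> G then d x else 0"
    have "x = (\<Sum>x\<in>F \<union> G. x * ?c x)"
      unfolding F(4) by (rule sum.mono_neutral_cong_left) (use F(1) G(1) in auto)
    moreover have "y = (\<Sum>x\<in>F \<union> G. x * ?d x)"
      unfolding G(4) by (rule sum.mono_neutral_cong_left) (use F(1) G(1) in auto)
    ultimately have "x + y = (\<Sum>x\<in>F \<union> G. x * (?c x + ?d x))"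
      by (simp only: distrib_left sum.distrib)
    also have "\<dots> \<in> right_span A X"
      by (rule right_spanI) (use F G sub in \<open>auto simp: subspace_add subspace_0\<close>)
    finally show ?thesis .
  qed
  show "scale k x \<in> right_span A X" if "x \<in> right_span A X" for k x
  proof -
    from that obtain F c where F: "finite F" "F \<subseteq> X" "\<forall>x\<in>F. c x \<in> A" "x = (\<Sum>x\<in>F. x * c x)"
      by (rule right_spanE)
    have "scale k x = (\<Sum>x\<in>F. x * scale k (c x))"
      by (simp add: F(4) scale_sum_right scale_mult_right)
    also have "\<dots> \<in> right_span A X"
      by (rule right_spanI) (use F sub in \<open>auto simp: subspace_scale\<close>)
    finally show ?thesis .
  qed
qed

lemma right_span_mult: "b \<in> right_span A X \<Longrightarrow> a \<in> A \<Longrightarrow> b * a \<in> right_span A X"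
proof -
  assume "b \<in> right_span A X" and a: "a \<in> A"
  then obtain F c where F: "finite F" "F \<subseteq> X" "\<forall>x\<in>F. c x \<in> A" "b = (\<Sum>x\<in>F. x * c x)"
    by (elim right_spanE)
  have "b * a = (\<Sum>x\<in>F. x * (c x * a))" by (simp add: F(4) sum_distrib_right mult.assoc)
  also have "\<dots> \<in> right_span A X"
    by (rule right_spanI) (use F A a in \<open>auto simp: subalgebra_def\<close>)
  finally show ?thesis .
qed

lemma right_span_insert:
  "right_span A (insert m X) = {m * a + y | a y. a \<in> A \<and> y \<in> right_span A X}" (is "_ = ?R")
proof
  show "right_span A (insert m X) \<subseteq> ?R"
  proof
    fix b assume "b \<in> right_span A (insert m X)"
    then obtain F c where F: "finite F" "F \<subseteq> insert m X" "\<forall>x\<in>F. c x \<in> A" "b = (\<Sum>x\<in>F. x * c x)"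
      by (rule right_spanE)
    define a where "a = (if m \<in> F then c m else 0)"
    have "a \<in> A" using F(3) A by (auto simp: a_def subalgebra_def subspace_0)
    moreover have "(\<Sum>x\<in>F - {m}. x * c x) \<in> right_span A X"
      by (rule right_spanI) (use F in auto)
    moreover have "b = m * a + (\<Sum>x\<in>F - {m}. x * c x)"
      using F(1,4) by (auto simp: a_def sum.remove)
    ultimately show "b \<in> ?R" by blast
  qed
  show "?R \<subseteq> right_span A (insert m X)"
    using right_span_base[of m "insert m X"] right_span_mono[of X "insert m X" A]
    by (auto intro!: subspace_add subspace_right_span)
qed

text \<open>The condition on \<open>m\<close> says that \<open>a \<mapsto> m * a\<close> embeds
  \<open>A\<close> in the quotient by \<open>right_span A X\<close>. In a relation the other terms
  put \<open>m * c m\<close> into that span, so \<open>c m = 0\<close> and a relation over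
  \<open>X\<close> remains.\<close>

lemma right_independent_insert:
  assumes "right_independent A X" "\<And>a. a \<in> A \<Longrightarrow> m * a \<in> right_span A X \<Longrightarrow> a = 0"
  shows "right_independent A (insert m X)"
  unfolding right_independent_def
proof (intro allI impI)
  fix F c
  assume F: "finite F \<and> F \<subseteq> insert m X \<and> (\<forall>x\<in>F. c x \<in> A) \<and> (\<Sum>x\<in>F. x * c x) = 0"
  let ?s = "\<Sum>x\<in>F - {m}. x * c x"
  have "?s \<in> right_span A X" by (rule right_spanI) (use F in auto)
  then have neg: "- ?s \<in> right_span A X" by (rule subspace_neg[OF subspace_right_span])
  have cm: "c m = 0" if "m \<in> F"
  proof (rule assms(2))
    have "m * c m = - ?s" using F sum.remove[of F m "\<lambda>x. x * c x"] that by (simp add: eq_neg_iff_add_eq_0)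
    then show "m * c m \<in> right_span A X" using neg by simp
  qed (use F that in simp)
  then have "?s = 0" using F sum.remove[of F m "\<lambda>x. x * c x"] by (cases "m \<in> F") auto
  moreover have "finite (F - {m})" "F - {m} \<subseteq> X" "\<forall>x\<in>F - {m}. c x \<in> A" using F by auto
  ultimately have "\<forall>x\<in>F - {m}. c x = 0" using assms(1) unfolding right_independent_def by blast
  then show "\<forall>x\<in>F. c x = 0" using cm by auto
qed

end

end

section \<open>Freeness over comodule subalgebras\<close>

text \<open>The counit axiom at \<open>g\<close> gives \<open>\<epsilon> g = 1\<close>, and then the
  antipode axiom at \<open>g\<close> is the claim.\<close>

lemma (in hopf_algebra) grouplike_antipode:
  assumes "\<Delta> g = tens scale scale g g" "g \<noteq> 0"
  shows "S g * g = 1"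
proof -
  note vs = vector_space_axioms
  have "scale (\<epsilon> g) g = scale 1 g"
    using counit_left[of g] lslice_tens[OF counit_linear vs, of g g] by (simp add: lslice_def assms(1))
  then have "\<epsilon> g = 1" using assms(2) unfolding scale_cancel_right by blast
  moreover have "bilinear_map scale scale scale (\<lambda>a b. S a * b)"
    by (rule bilinear_mapI[OF vs vs vs])
       (simp_all add: linear_props[OF antipode_linear] distrib_left distrib_right
         scale_mult_left scale_mult_right)
  ultimately show ?thesis
    using antipode_left[of g] by (simp add: assms(1) tensor_lift_tens)
qed

section \<open>Semi-invariants, their annihilators, and freeness\<close>

context comodule_algebra
begin

text \<open>The image of \<open>m\<close> in \<open>B / M\<close> is a semi-invariant of weight \<open>g\<close>.\<close>

definition semi_invariant :: "'b set \<Rightarrow> 'h \<Rightarrow> 'b \<Rightarrow> bool" where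
  "semi_invariant M g m \<longleftrightarrow> g \<noteq> 0 \<and> \<Delta> g = tens scaleH scaleH g g \<and>
     (\<forall>f. linear_form scaleH f \<longrightarrow> act f m - scaleB (f g) m \<in> M)"

lemma pointed_exists_semi_invariant:
  assumes "H.pointed" "subcomodule N" "subcomodule M" "b \<in> N" "b \<notin> M"
  shows "\<exists>m g. m \<in> N \<and> m \<notin> M \<and> semi_invariant M g m"
proof (rule pointed_obtains_semi_invariant[OF assms])
  fix m g
  assume "m \<in> N" "m \<notin> M" "g \<noteq> 0" "\<Delta> g = tens scaleH scaleH g g"
    "\<And>f. linear_form scaleH f \<Longrightarrow> act f m - scaleB (f g) m \<in> M"
  then show ?thesis by (intro exI[of _ m] exI[of _ g]) (simp add: semi_invariant_def)
qed

lemma linear_form_mult_left: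
  assumes "linear_form scaleH f"
  shows "linear_form scaleH (\<lambda>h. f (g * h))"
  by (rule linearI)
     (simp_all add: vsH vector_space_mult linear_props[OF assms] distrib_left H.scale_mult_right)

text \<open>Modulo \<open>H \<otimes> M\<close>, \<open>\<rho> (m * a)\<close> is the product of
  \<open>g \<otimes> m\<close> with \<open>\<rho> a\<close>, because \<open>M\<close> absorbs right
  multiplication by \<open>A\<close>. Slicing by \<open>f\<close> then turns the factor
  \<open>g\<close> into a shift of the argument of \<open>f\<close>.\<close>

lemma act_semi_invariant_mult:
  assumes m: "semi_invariant M g m" and M: "V.subspace M" "\<And>x a. x \<in> M \<Longrightarrow> a \<in> A \<Longrightarrow> x * a \<in> M"
    and A: "subcomodule A" "a \<in> A" and f: "linear_form scaleH f"
  shows "act f (m * a) - m * act (\<lambda>h. f (g * h)) a \<in> M"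
proof -
  interpret t: vector_space tscale by (rule vector_space_tscale)
  \<comment> \<open>\<open>?T\<close> is the deviation of \<open>\<rho> m\<close> from
    \<open>g \<otimes> m\<close>; semi-invariance puts its left slices into \<open>M\<close>, hence
    \<open>?T\<close> itself into \<open>H \<otimes> M\<close>.\<close>
  let ?T = "\<rho> m - tens scaleH scaleB g m"
  have gm: "tens scaleH scaleB g m \<in> tensor_space scaleH scaleB UNIV UNIV"
    by (intro tens_in_tensor_space UNIV_I)
  then have T: "?T \<in> tensor_space scaleH scaleB UNIV UNIV"
    using coact_in_tensor by (intro t.subspace_diff subspace_tensor_space)
  have "?T \<in> tensor_space scaleH scaleB UNIV M"
  proof (rule tensor_space_left_slices[OF vsH vsV T])
    fix f assume f: "linear_form scaleH f"
    have "lslice scaleH scaleB f ?T + scaleB (f g) m = act f m"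
      using lslice_add[OF f vsV T gm] by (simp add: lslice_tens[OF f vsV] act_def)
    then have "lslice scaleH scaleB f ?T = act f m - scaleB (f g) m" by (simp add: algebra_simps)
    then show "lslice scaleH scaleB f ?T \<in> M" using m f by (simp add: semi_invariant_def)
  qed
  then obtain xs where xs: "?T = (\<Sum>(v, w)\<leftarrow>xs. tens scaleH scaleB v w)" "set xs \<subseteq> UNIV \<times> M"
    by (rule tensor_space_sum_listE[OF vsH vsV H.subspace_UNIV])
  have "\<rho> a \<in> tensor_space scaleH scaleB UNIV A" using A by (auto simp: subcomodule_def)
  then obtain ys where ys: "\<rho> a = (\<Sum>(v, w)\<leftarrow>ys. tens scaleH scaleB v w)" "set ys \<subseteq> UNIV \<times> A"
    by (rule tensor_space_sum_listE[OF vsH vsV H.subspace_UNIV])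
  have "\<rho> m = tens scaleH scaleB g m + ?T" by simp
  \<comment> \<open>The head of the list carries the main term, the tail the part in
    \<open>H \<otimes> M\<close>.\<close>
  then have "\<rho> m = (\<Sum>(v, w)\<leftarrow>(g, m) # xs. tens scaleH scaleB v w)" unfolding xs(1) by simp
  then have \<rho>: "\<rho> (m * a) =
      (\<Sum>(x, y)\<leftarrow>(g, m) # xs. \<Sum>(c, d)\<leftarrow>ys. tens scaleH scaleB (x * c) (y * d))"
    by (simp only: coact_mult ys(1)
        tensor_mult_sum_list[OF H.unital_algebra_axioms B.unital_algebra_axioms])
  note bl = bilinear_map_lslice[OF f vsV]
  have inner: "(\<Sum>(c, d)\<leftarrow>ys. tens scaleH scaleB (x * c) (y * d))
      \<in> tensor_space scaleH scaleB UNIV UNIV" for x y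
    by (rule tensor_space_sum_listI) (auto intro: tens_in_tensor_space)
  have sl: "lslice scaleH scaleB f (\<Sum>(c, d)\<leftarrow>ys. tens scaleH scaleB (x * c) (y * d)) =
      (\<Sum>(c, d)\<leftarrow>ys. scaleB (f (x * c)) (y * d))" for x y
    unfolding lslice_def
    by (subst tensor_lift_sum[OF bl])
       (auto simp: case_prod_unfold tens_in_tensor_space tensor_lift_tens[OF bl])
  have "act f (m * a) = (\<Sum>(x, y)\<leftarrow>(g, m) # xs.
      lslice scaleH scaleB f (\<Sum>(c, d)\<leftarrow>ys. tens scaleH scaleB (x * c) (y * d)))"
    unfolding act_def \<rho> lslice_def
    by (subst tensor_lift_sum[OF bl])
       (use inner in \<open>auto simp: case_prod_unfold\<close>)
  also have "\<dots> = (\<Sum>(x, y)\<leftarrow>(g, m) # xs. \<Sum>(c, d)\<leftarrow>ys. scaleB (f (x * c)) (y * d))"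
    by (simp only: sl)
  finally have 1: "act f (m * a) = (\<Sum>(c, d)\<leftarrow>ys. scaleB (f (g * c)) (m * d)) +
      (\<Sum>(x, y)\<leftarrow>xs. \<Sum>(c, d)\<leftarrow>ys. scaleB (f (x * c)) (y * d))" by simp
  have lm: "Vector_Spaces.linear scaleB scaleB ((*) m)"
    by (rule linearI) (simp_all add: vsV distrib_left B.scale_mult_right)
  have "m * act (\<lambda>h. f (g * h)) a = (\<Sum>(c, d)\<leftarrow>ys. scaleB (f (g * c)) (m * d))"
    unfolding act_def ys(1) lslice_sum_list[OF linear_form_mult_left[OF f] vsV] linear_sum_list[OF lm]
    by (simp add: case_prod_unfold B.scale_mult_right)
  moreover have "(\<Sum>(c, d)\<leftarrow>zs. scaleB (f (x * c)) (y * d)) \<in> M" if "y \<in> M" "set zs \<subseteq> set ys" for x y zs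
    using that ys(2) by (induction zs)
      (auto simp: V.subspace_0[OF M(1)] intro!: V.subspace_add[OF M(1)] V.subspace_scale[OF M(1)] M(2))
  then have "(\<Sum>(x, y)\<leftarrow>zs. \<Sum>(c, d)\<leftarrow>ys. scaleB (f (x * c)) (y * d)) \<in> M" if "set zs \<subseteq> set xs" for zs
    using that xs(2) by (induction zs)
      (auto simp: V.subspace_0[OF M(1)] intro!: V.subspace_add[OF M(1)])
  ultimately show ?thesis by (simp add: 1)
qed

text \<open>Applying \<open>act_semi_invariant_mult\<close> to the form
  \<open>h \<mapsto> f (S g * h)\<close> cancels the shift by \<open>g\<close>, as
  \<open>S g\<close> is a left inverse of \<open>g\<close>. So \<open>m * act f a\<close> is
  congruent modulo \<open>M\<close> to the action of that form on \<open>m * a\<close>, which lies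
  in \<open>M\<close>.\<close>

lemma subcomodule_semi_invariant_annihilator:
  assumes m: "semi_invariant M g m" and M: "subcomodule M" "\<And>x a. x \<in> M \<Longrightarrow> a \<in> A \<Longrightarrow> x * a \<in> M"
    and A: "subcomodule A"
  shows "subcomodule {a \<in> A. m * a \<in> M}"
  unfolding subcomodule_iff_stable stable_def
proof (intro conjI allI impI)
  have sM: "V.subspace M" and sA: "V.subspace A" using M(1) A by (simp_all add: subcomodule_def)
  show "V.subspace {a \<in> A. m * a \<in> M}"
    using sM sA by (intro V.subspaceI)
      (auto simp: V.subspace_0 V.subspace_add V.subspace_scale distrib_left B.scale_mult_right)
  fix f assume f: "linear_form scaleH f"
  show "act f ` {a \<in> A. m * a \<in> M} \<subseteq> {a \<in> A. m * a \<in> M}"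
  proof clarsimp
    fix a assume a: "a \<in> A" "m * a \<in> M"
    have inv: "S g * g = 1" using m H.grouplike_antipode by (simp add: semi_invariant_def)
    let ?f = "\<lambda>h. f (S g * h)"
    have f': "linear_form scaleH ?f" by (rule linear_form_mult_left[OF f])
    have "act ?f (m * a) - m * act (\<lambda>h. ?f (g * h)) a \<in> M"
      by (rule act_semi_invariant_mult[OF m sM M(2) A a(1) f'])
    moreover have "(\<lambda>h. ?f (g * h)) = f" by (simp add: mult.assoc[symmetric] inv)
    ultimately have "act ?f (m * a) - m * act f a \<in> M" by simp
    moreover have "act ?f (m * a) \<in> M" using M(1) f' a(2) by (auto simp: subcomodule_iff_stable stable_def)
    ultimately have "act ?f (m * a) - (act ?f (m * a) - m * act f a) \<in> M" using sM V.subspace_diff by blast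
    moreover have "act f a \<in> A" using A f a(1) by (auto simp: subcomodule_iff_stable stable_def)
    ultimately show "act f a \<in> A \<and> m * act f a \<in> M" by simp
  qed
qed

lemma subcomodule_zero: "subcomodule {0}"
  unfolding subcomodule_iff_stable stable_def
  by (auto simp: V.subspace_single_0 linear_props(3)[OF linear_act])

lemma subcomodule_UNIV: "subcomodule UNIV"
  unfolding subcomodule_iff_stable stable_def by auto

text \<open>
  A semi-invariant \<open>b\<close> of \<open>J\<close> is not a left zero divisor, as its right annihilator is a proper
  \<open>H\<close>-costable right ideal of \<open>B\<close>. Hence \<open>b * A = A\<close> by finite-dimensionality.
\<close>

lemma one_in_costable_right_ideal:
  assumes pointed: "H.pointed" and simple: "right_H_simple"
    and A: "comodule_subalgebra A" "finite_dim A"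
    and J: "subcomodule J" "J \<subseteq> A" "J \<noteq> {0}" "\<And>x a. x \<in> J \<Longrightarrow> a \<in> A \<Longrightarrow> x * a \<in> J"
  shows "1 \<in> J"
proof -
  have "0 \<in> J" using J(1) by (simp add: subcomodule_def V.subspace_0)
  then obtain b0 where "b0 \<in> J" "b0 \<notin> {0}" using J(3) by blast
  from pointed_exists_semi_invariant[OF pointed J(1) subcomodule_zero this]
  obtain b g where b: "b \<in> J" "b \<notin> {0}" and si: "semi_invariant {0} g b" by (elim exE conjE)
  \<comment> \<open>The annihilator lemma is used with all of \<open>B\<close> for \<open>A\<close>
    and zero for \<open>M\<close>; the trivial condition \<open>x \<in> UNIV\<close> matches its
    form.\<close>
  let ?N = "{x \<in> UNIV. b * x \<in> {0}}"
  have "subcomodule ?N"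
    by (rule subcomodule_semi_invariant_annihilator[OF si subcomodule_zero _ subcomodule_UNIV]) simp
  moreover have "right_ideal ?N"
    by (auto simp: right_ideal_def distrib_left mult.assoc[symmetric])
  ultimately have "?N = {0} \<or> ?N = UNIV" using simple unfolding right_H_simple_def by blast
  moreover have "1 \<notin> ?N" using b(2) by simp
  ultimately have N: "?N = {0}" by blast
  have inj: "x = y" if "b * x = b * y" for x y
  proof -
    have "x - y \<in> ?N" using that by (simp add: right_diff_distrib)
    then show ?thesis unfolding N by simp
  qed
  obtain F where F: "finite F" "V.span F = A" using A(2) by (auto simp: finite_dim_def)
  have "(*) b ` A = A"
  proof (rule V.injective_image_eq[OF F])
    show "Vector_Spaces.linear scaleB scaleB ((*) b)"
      by (rule linearI) (simp_all add: vsV distrib_left B.scale_mult_right)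
    show "(*) b ` A \<subseteq> A" using J(2,4) b(1) by blast
    show "inj_on ((*) b) A" by (rule inj_onI) (rule inj)
  qed
  moreover have "1 \<in> A" using A(1) by (simp add: comodule_subalgebra_def B.subalgebra_def)
  ultimately obtain a where a: "a \<in> A" "1 = b * a" by blast
  show ?thesis unfolding a(2) by (rule J(4)[OF b(1) a(1)])
qed

text \<open>Zorn's lemma runs over independent sets whose right span is a subcomodule; the latter
  keeps semi-invariants of the quotient available. If a maximal set did not span, such a
  semi-invariant could be adjoined.\<close>

lemma free_over_finite_dim_comodule_subalgebra:
  assumes pointed: "H.pointed" and simple: "right_H_simple"
    and A: "comodule_subalgebra A" "finite_dim A"
  shows "free_right_module A"
proof -
  have sA: "B.subalgebra A" and cA: "subcomodule A" using A(1) by (simp_all add: comodule_subalgebra_def)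
  note sub = B.subspace_right_span[OF sA]
  let ?X = "{X. right_independent A X \<and> subcomodule (right_span A X)}"
  have "right_independent A {}" "right_span A {} = {0}"
    by (auto simp: right_independent_def right_span_def)
  then have ne: "?X \<noteq> {}" using subcomodule_zero by (auto intro!: exI[of _ "{}"])
  have "\<Union>C \<in> ?X" if C: "C \<noteq> {}" "subset.chain ?X C" for C
  proof -
    have CX: "C \<subseteq> ?X" using C(2) by (simp add: subset_chain_def)
    have "act f b \<in> right_span A (\<Union>C)" if f: "linear_form scaleH f" and b: "b \<in> right_span A (\<Union>C)" for f b
    proof -
      obtain X where X: "X \<in> C" "b \<in> right_span A X"
        using b unfolding right_span_Union_chain[OF C] by blast
      then have "act f b \<in> right_span A X"
        using CX f by (auto simp: subcomodule_iff_stable stable_def)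
      then show ?thesis using X(1) unfolding right_span_Union_chain[OF C] by blast
    qed
    then have "subcomodule (right_span A (\<Union>C))"
      unfolding subcomodule_iff_stable stable_def using sub by auto
    moreover have "right_independent A (\<Union>C)"
      by (rule right_independent_Union_chain[OF C]) (use CX in auto)
    ultimately show ?thesis by simp
  qed
  from subset_Zorn_nonempty[OF ne this]
  obtain X where X: "X \<in> ?X" and max: "\<forall>Y\<in>?X. X \<subseteq> Y \<longrightarrow> Y = X" ..
  let ?M = "right_span A X"
  have cM: "subcomodule ?M" and mM: "\<And>x a. x \<in> ?M \<Longrightarrow> a \<in> A \<Longrightarrow> x * a \<in> ?M"
    using X B.right_span_mult[OF sA] by auto
  have "?M = UNIV"
  proof (rule ccontr)
    assume "?M \<noteq> UNIV"
    then obtain b where "b \<notin> ?M" by blast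
    from pointed_exists_semi_invariant[OF pointed subcomodule_UNIV cM UNIV_I this]
    obtain m g where m: "m \<notin> ?M" and si: "semi_invariant ?M g m" by (elim exE conjE)
    \<comment> \<open>This is the kernel of \<open>a \<mapsto> m * a\<close> into
      \<open>B / ?M\<close>. If it were nonzero it would contain \<open>1\<close>, and
      \<open>m\<close> would lie in \<open>?M\<close>.\<close>
    let ?J = "{a \<in> A. m * a \<in> ?M}"
    have J: "subcomodule ?J" by (rule subcomodule_semi_invariant_annihilator[OF si cM mM cA])
    have "?J = {0}"
    proof (rule ccontr)
      assume J0: "?J \<noteq> {0}"
      have "1 \<in> ?J"
        by (rule one_in_costable_right_ideal[OF pointed simple A J _ J0])
           (use sA mM in \<open>auto simp: B.subalgebra_def mult.assoc[symmetric]\<close>)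
      then show False using m(1) by simp
    qed
    then have "right_independent A (insert m X)" (is ?ind)
      using X by (intro B.right_independent_insert[OF sA]) auto
    \<comment> \<open>Modulo \<open>?M\<close>, acting on \<open>m * a\<close> gives
      \<open>m\<close> times another element of \<open>A\<close>, so the enlarged span is again a
      subcomodule.\<close>
    have act_insert: "act f (m * a + y) \<in> right_span A (insert m X)"
      if f: "linear_form scaleH f" and a: "a \<in> A" and y: "y \<in> ?M" for f a y
    proof -
      let ?a = "act (\<lambda>h. f (g * h)) a"
      have "act f (m * a) - m * ?a \<in> ?M"
        by (rule act_semi_invariant_mult[OF si sub mM cA a f])
      moreover have "act f y \<in> ?M" using cM f y by (auto simp: subcomodule_iff_stable stable_def)
      ultimately have "act f (m * a) - m * ?a + act f y \<in> ?M" using sub V.subspace_add by blast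
      moreover have "?a \<in> A" using cA linear_form_mult_left[OF f] a
        by (auto simp: subcomodule_iff_stable stable_def)
      moreover have "act f (m * a + y) = m * ?a + (act f (m * a) - m * ?a + act f y)"
        by (simp add: linear_props(1)[OF linear_act[OF f]])
      ultimately show ?thesis unfolding B.right_span_insert[OF sA] by blast
    qed
    have "subcomodule (right_span A (insert m X))"
      unfolding subcomodule_iff_stable stable_def
    proof (intro conjI sub allI impI image_subsetI)
      fix f b assume f: "linear_form scaleH f" and "b \<in> right_span A (insert m X)"
      then obtain a y where "b = m * a + y" "a \<in> A" "y \<in> ?M"
        unfolding B.right_span_insert[OF sA] by blast
      then show "act f b \<in> right_span A (insert m X)" using act_insert[OF f] by simp
    qed
    \<comment> \<open>Maximality puts \<open>m\<close> into \<open>X\<close>, hence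
      \<open>m * 1\<close> into its span, contrary to the choice of \<open>m\<close>.\<close>
    then have "insert m X = X" using \<open>?ind\<close> max by (simp add: subset_insertI)
    then have "m * 1 \<in> ?M" using sA by (intro right_span_base) (auto simp: B.subalgebra_def)
    then show False using m(1) by simp
  qed
  then have "right_module_basis A X" using X by (simp add: right_module_basis_iff)
  then show ?thesis by (auto simp: free_right_module_def)
qed

end

theorem corollary4p20:
  fixes scaleH :: "'k::field \<Rightarrow> 'h::ring_1 \<Rightarrow> 'h"
    and \<Delta> :: "'h \<Rightarrow> ('k, 'h, 'h) tensor"
    and \<epsilon> :: "'h \<Rightarrow> 'k"
    and S :: "'h \<Rightarrow> 'h"
    and scaleB :: "'k \<Rightarrow> 'b::ring_1 \<Rightarrow> 'b"
    and \<rho> :: "'b \<Rightarrow> ('k, 'h, 'b) tensor"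
    and A :: "'b set"
  assumes "hopf_algebra scaleH \<Delta> \<epsilon> S"
    and "coalgebra.pointed scaleH \<Delta>"
    and "comodule_algebra scaleH \<Delta> \<epsilon> S scaleB \<rho>"
    and "comodule_algebra.right_H_simple scaleH scaleB \<rho>"
    and "comodule_algebra.comodule_subalgebra scaleH scaleB \<rho> A"
    and "comodule_algebra.finite_dim scaleB A"
  shows "free_right_module A"
proof -
  interpret comodule_algebra scaleH \<Delta> \<epsilon> S scaleB \<rho> by fact
  show ?thesis
    using assms by (intro free_over_finite_dim_comodule_subalgebra)
qed

end
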